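(* There exists an integer $s_0$ such that the following holds for all positive integers $n, k$ and all integers $s \ge s_0$: if $\mathcal F_1,\ldots,\mathcal F_s\subset [n]^k$ satisfy $|\mathcal F_i|>(s-1)n^{k-1}$ for all $i\in[s]$, then there exist $F_1\in\mathcal F_1,\ldots,F_s\in\mathcal F_s$ such that $F_i\cap F_j=\emptyset$ for all $1\le i<j\le s$.
   Context: $[n]=\{1,\ldots,n\}$, and $[n]^k$ is the set of $k$-tuples with entries in $[n]$. Two tuples $F=(f_1,\ldots,f_k)$ and $F'=(f'_1,\ldots,f'_k)$ in $[n]^k$ are said to intersect if $f_i=f'_i$ for some $1\le i\le k$; $F\cap F'=\emptyset$ means that they do not intersect. A collection $F_1\in\mathcal F_1,\ldots,F_s\in\mathcal F_s$ of pairwise non-intersecting tuples is called a rainbow $s$-matching. *)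

theory Defs
  imports "HOL-Library.FuncSet"
begin

definition tuples :: "nat \<Rightarrow> nat \<Rightarrow> (nat \<Rightarrow> nat) set" where
  "tuples n k = ({1..k} \<rightarrow>\<^sub>E {1..n})"

definition tuples_intersect :: "nat \<Rightarrow> (nat \<Rightarrow> nat) \<Rightarrow> (nat \<Rightarrow> nat) \<Rightarrow> bool" where
  "tuples_intersect k F F' \<longleftrightarrow> (\<exists>i\<in>{1..k}. F i = F' i)"

definition rainbow_matching ::
    "nat \<Rightarrow> nat \<Rightarrow> (nat \<Rightarrow> (nat \<Rightarrow> nat) set) \<Rightarrow> (nat \<Rightarrow> nat \<Rightarrow> nat) \<Rightarrow> bool" where
  "rainbow_matching k s \<F> F \<longleftrightarrow>
     (\<forall>i\<in>{1..s}. F i \<in> \<F> i) \<and>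
     (\<forall>i j. 1 \<le> i \<and> i < j \<and> j \<le> s \<longrightarrow> \<not> tuples_intersect k (F i) (F j))"

end

theory Submission
  imports Defs Complex_Main "HOL-Combinatorics.Permutations"
begin

text \<open>Take a uniformly random perfect matching of \<open>[n]\<^sup>k\<close> (\<open>n\<close> disjoint tuples), and let \<open>X\<^sub>i\<close> be the
  number of its tuples in \<open>\<F>\<^sub>i\<close> and \<open>y\<^sub>i = X\<^sub>i - (s - 1)\<close>, so that \<open>y\<^sub>i\<close> has positive mean. If greedy
  choice of distinct tuples fails, then for some \<open>j < s\<close> more than \<open>j\<close> of the \<open>X\<^sub>i\<close> are at most \<open>j\<close>.
  As long as all \<open>y\<^sub>i\<close> lie in \<open>[- s / 2, s / 4]\<close>, this forces \<open>\<Sum> (y\<^sub>i + \<bar>y\<^sub>i\<bar> / 3) \<le> 0\<close>, against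
  the positive mean. So it suffices that the contribution of \<open>y\<^sub>i\<close> outside this range is small
  compared with the mean of \<open>\<bar>y\<^sub>i\<bar>\<close>.

  This relative concentration follows from a Poincare inequality for the random matching, with
  respect to jointly resampling two of its tuples, whose constant does not depend on \<open>k\<close>. Since
  such a step changes \<open>X\<^sub>i\<close> only if it involves one of the \<open>X\<^sub>i\<close> tuples in \<open>\<F>\<^sub>i\<close> (before or after the
  step) and then by at most 2, applying the inequality to \<open>(y\<^sub>i - a)\<^sup>+\<close> or \<open>(- y\<^sub>i - a)\<^sup>+\<close> bounds the
  tail beyond \<open>a + d\<close> by \<open>O(s / d\<^sup>2)\<close> times (essentially) the tail beyond \<open>a\<close>.\<close>

section \<open>The spectral gap of random transpositions\<close>

text \<open>This is \<open>card A\<close> times the variance of \<open>f\<close> under the uniform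
  distribution on \<open>A\<close>. Without normalisation, contributions of fibres add up with no
  weights.\<close>

definition sum_var :: "'a set \<Rightarrow> ('a \<Rightarrow> real) \<Rightarrow> real" where
  "sum_var A f = (\<Sum>x\<in>A. (f x)\<^sup>2) - (\<Sum>x\<in>A. f x)\<^sup>2 / card A"

lemma sum_sq_dev:
  fixes f :: "'a \<Rightarrow> real" and m :: real
  assumes "finite A"
  shows "(\<Sum>x\<in>A. (f x - m)\<^sup>2) = (\<Sum>x\<in>A. (f x)\<^sup>2) - 2 * m * (\<Sum>x\<in>A. f x) + card A * m\<^sup>2"
  by (simp add: power2_diff sum.distrib sum_subtractf sum_distrib_left sum_distrib_right algebra_simps)

lemma sum_var_eq_sum_sq_dev:
  assumes "finite A" "A \<noteq> {}"
  shows "sum_var A f = (\<Sum>x\<in>A. (f x - (\<Sum>x\<in>A. f x) / card A)\<^sup>2)"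
  using assms unfolding sum_sq_dev[OF assms(1)] sum_var_def
  by (simp add: field_simps power2_eq_square)

text \<open>A permutation with value \<open>v\<close> at \<open>i\<close> factors uniquely as
  \<open>transpose i v \<circ> q\<close> with \<open>q\<close> fixing \<open>i\<close>. This is
  conditioning on the value at \<open>i\<close>.\<close>

lemma sum_permutes_fix_value:
  assumes "finite A" "i \<in> A"
  shows "(\<Sum>p | p permutes A. F p) = (\<Sum>v\<in>A. \<Sum>q | q permutes (A - {i}). F (transpose i v \<circ> q))"
  using sum_over_permutations_insert[of "A - {i}" i F] assms by (simp add: insert_absorb)

lemma permutes_fix_value_apply:
  assumes "q permutes (A - {i})"
  shows "(transpose i v \<circ> q) i = v"
  using permutes_not_in[OF assms, of i] by simp

lemma sum_permutes_one_point:
  fixes \<phi> :: "'a \<Rightarrow> real"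
  assumes "finite A" "i \<in> A"
  shows "(\<Sum>p | p permutes A. \<phi> (p i)) = fact (card A - 1) * (\<Sum>v\<in>A. \<phi> v)"
proof -
  have c: "card {q. q permutes (A - {i})} = fact (card A - 1)"
    using assms by (intro card_permutations) auto
  have "(\<Sum>p | p permutes A. \<phi> (p i)) = (\<Sum>v\<in>A. \<Sum>q | q permutes (A - {i}). \<phi> v)"
    unfolding sum_permutes_fix_value[OF assms]
    by (intro sum.cong refl) (simp add: permutes_fix_value_apply[unfolded comp_apply])
  then show ?thesis by (simp add: c sum_distrib_left)
qed

lemma sum_permutes_two_points:
  fixes \<phi> \<psi> :: "'a \<Rightarrow> real"
  assumes "finite A" "i \<in> A" "j \<in> A" "i \<noteq> j"
  shows "(\<Sum>p | p permutes A. \<phi> (p i) * \<psi> (p j)) =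
    fact (card A - 2) * (\<Sum>v\<in>A. \<phi> v * ((\<Sum>w\<in>A. \<psi> w) - \<psi> v))"
proof -
  have "(\<Sum>p | p permutes A. \<phi> (p i) * \<psi> (p j)) =
      (\<Sum>v\<in>A. \<Sum>q | q permutes (A - {i}). \<phi> v * \<psi> (transpose i v (q j)))"
    unfolding sum_permutes_fix_value[OF assms(1,2)]
    by (intro sum.cong refl) (simp add: permutes_fix_value_apply[unfolded comp_apply])
  also have "\<dots> = (\<Sum>v\<in>A. \<phi> v * (fact (card A - 2) * (\<Sum>u\<in>A - {i}. \<psi> (transpose i v u))))"
    using sum_permutes_one_point[of "A - {i}" j "\<lambda>u. \<psi> (transpose i _ u)"] assms
    by (intro sum.cong refl) (simp add: sum_distrib_left[symmetric] numeral_2_eq_2)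
  also have "\<dots> = (\<Sum>v\<in>A. \<phi> v * (fact (card A - 2) * (\<Sum>w\<in>A - {v}. \<psi> w)))"
  proof (intro sum.cong refl)
    fix v assume v: "v \<in> A"
    \<comment> \<open>\<open>transpose i v\<close> maps \<open>A - {i}\<close> bijectively onto the
      values still available, \<open>A - {v}\<close>.\<close>
    have "(\<Sum>w\<in>A - {v}. \<psi> w) = (\<Sum>u\<in>A - {i}. \<psi> (transpose i v u))"
      by (rule sum.reindex_bij_witness[of _ "transpose i v" "transpose i v"])
        (use v assms in \<open>auto simp: transpose_def\<close>)
    then show "\<phi> v * (fact (card A - 2) * (\<Sum>u\<in>A - {i}. \<psi> (transpose i v u))) =
        \<phi> v * (fact (card A - 2) * (\<Sum>w\<in>A - {v}. \<psi> w))" by simp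
  qed
  finally show ?thesis
    using assms by (simp add: sum_diff1 sum_distrib_left[of "fact (card A - 2)"] mult.left_commute)
qed

text \<open>Law of total variance for conditioning on \<open>p i\<close>: the variance inside the
  fibres \<open>p i = v\<close>, plus the variance of the fibre means.\<close>

lemma sum_var_permutes_fix_value:
  fixes f :: "('a \<Rightarrow> 'a) \<Rightarrow> real"
  assumes "finite A" "i \<in> A"
  defines "m \<equiv> (\<Sum>p | p permutes A. f p) / fact (card A)"
  shows "sum_var {p. p permutes A} f =
    (\<Sum>v\<in>A. sum_var {q. q permutes (A - {i})} (\<lambda>q. f (transpose i v \<circ> q))) +
    fact (card A - 1) * (\<Sum>v\<in>A. ((\<Sum>q | q permutes (A - {i}). f (transpose i v \<circ> q)) / fact (card A - 1) - m)\<^sup>2)"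
proof -
  define s where "s v = (\<Sum>q | q permutes (A - {i}). f (transpose i v \<circ> q))" for v
  define N where "N = (fact (card A - 1) :: real)"
  have N: "N > 0" by (simp add: N_def)
  have n: "card A > 0" using assms by (auto simp: card_gt_0_iff)
  have c: "card {q. q permutes (A - {i})} = fact (card A - 1)"
    using assms by (intro card_permutations) auto
  have cA: "card {p. p permutes A} = fact (card A)"
    using assms by (intro card_permutations) auto
  have fA: "(fact (card A) :: real) = card A * N"
    using n by (simp add: N_def fact_reduce)
  have ss: "(\<Sum>p | p permutes A. f p) = (\<Sum>v\<in>A. s v)"
    unfolding s_def by (rule sum_permutes_fix_value[OF assms(1,2)])
  have m: "(\<Sum>v\<in>A. s v) = card A * N * m"
    unfolding m_def ss fA using n N by simp
  have 1: "(\<Sum>v\<in>A. (s v / N - m)\<^sup>2) = (\<Sum>v\<in>A. (s v)\<^sup>2) / N\<^sup>2 - 2 * m * (\<Sum>v\<in>A. s v) / N + card A * m\<^sup>2"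
    unfolding sum_sq_dev[OF assms(1)]
    by (simp add: power_divide flip: sum_divide_distrib)
  have 2: "N * (\<Sum>v\<in>A. (s v / N - m)\<^sup>2) = (\<Sum>v\<in>A. (s v)\<^sup>2) / N - (\<Sum>v\<in>A. s v)\<^sup>2 / (card A * N)"
    unfolding 1 m using N n by (simp add: field_simps power2_eq_square)
  show ?thesis
    unfolding s_def[symmetric] N_def[symmetric] 2 sum_var_def c cA of_nat_fact ss sum_permutes_fix_value[OF assms(1,2), of "\<lambda>p. (f p)\<^sup>2"]
    by (simp add: sum_subtractf fA flip: s_def sum_divide_distrib)
qed

lemma sum_var_nonneg:
  assumes "finite A"
  shows "sum_var A f \<ge> 0"
  using assms sum_var_eq_sum_sq_dev[of A f] by (cases "A = {}") (auto simp: sum_var_def sum_nonneg)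

text \<open>The projections onto functions of \<open>p i\<close> and of \<open>p j\<close> have correlation \<open>-1 / (n - 1)\<close>;
  testing \<open>f - m\<close> against the sum \<open>L\<close> of its one-point projections gives the bound.\<close>

lemma sum_one_point_variances_le:
  fixes f :: "('a \<Rightarrow> 'a) \<Rightarrow> real"
  assumes "finite A" "card A = n" "n \<ge> 2"
  defines "m \<equiv> (\<Sum>p | p permutes A. f p) / fact n"
  shows "(\<Sum>i\<in>A. fact (n - 1) * (\<Sum>v\<in>A. ((\<Sum>q | q permutes (A - {i}). f (transpose i v \<circ> q)) / fact (n - 1) - m)\<^sup>2))
    \<le> real n / (real n - 1) * sum_var {p. p permutes A} f"
proof -
  define a where "a i v = (\<Sum>q | q permutes (A - {i}). f (transpose i v \<circ> q)) / fact (n - 1) - m" for i v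
  define N where "N = (fact (n - 1) :: real)"
  define N' where "N' = (fact (n - 2) :: real)"
  define P where "P = {p. p permutes A}"
  define L where "L p = (\<Sum>i\<in>A. a i (p i))" for p
  define S where "S = (\<Sum>i\<in>A. N * (\<Sum>v\<in>A. (a i v)\<^sup>2))"
  have finP: "finite P" using assms by (simp add: P_def finite_permutations)
  have cP: "card P = fact n" using assms by (simp add: P_def card_permutations)
  have N: "N > 0" "N' > 0" "N = (real n - 1) * N'"
  proof -
    obtain l where "n = Suc (Suc l)" using assms(3) by (metis add_2_eq_Suc le_Suc_ex)
    then show "N = (real n - 1) * N'" by (simp add: N_def N'_def)
  qed (simp_all add: N_def N'_def)
  have fn: "(fact n :: real) = n * N" using assms by (simp add: N_def fact_reduce)
  have az: "(\<Sum>v\<in>A. a i v) = 0" if "i \<in> A" for i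
  proof -
    have "(\<Sum>v\<in>A. a i v) = (\<Sum>p\<in>P. f p) / N - n * m"
      unfolding a_def P_def sum_permutes_fix_value[OF assms(1) that]
      by (simp add: sum_subtractf assms N_def flip: sum_divide_distrib)
    also have "\<dots> = 0"
      unfolding m_def P_def fn using N assms(3) by (simp add: field_simps)
    finally show ?thesis .
  qed
  \<comment> \<open>\<open>a i (p i)\<close> is the projection of \<open>f - m\<close> onto
    functions of \<open>p i\<close>, so its inner product with \<open>f - m\<close> is its own
    squared norm.\<close>
  have fL: "(\<Sum>p\<in>P. (f p - m) * L p) = S"
  proof -
    have "(\<Sum>p\<in>P. (f p - m) * L p) = (\<Sum>i\<in>A. \<Sum>p\<in>P. (f p - m) * a i (p i))"
      unfolding L_def sum_distrib_left by (rule sum.swap)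
    also have "\<dots> = (\<Sum>i\<in>A. N * (\<Sum>v\<in>A. (a i v)\<^sup>2))"
    proof (intro sum.cong refl)
      fix i assume i: "i \<in> A"
      have c: "card {q. q permutes (A - {i})} = fact (n - 1)"
        using assms i by (intro card_permutations) auto
      have "(\<Sum>p\<in>P. (f p - m) * a i (p i)) =
          (\<Sum>v\<in>A. \<Sum>q | q permutes (A - {i}). (f (transpose i v \<circ> q) - m) * a i v)"
        unfolding P_def sum_permutes_fix_value[OF assms(1) i]
        by (intro sum.cong refl) (simp add: permutes_fix_value_apply[unfolded comp_apply])
      also have "\<dots> = (\<Sum>v\<in>A. N * a i v * a i v)"
      proof (intro sum.cong refl)
        fix v
        have "(\<Sum>q | q permutes (A - {i}). f (transpose i v \<circ> q) - m) = N * a i v"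
          using N(1) by (simp add: a_def sum_subtractf c N_def field_simps)
        then show "(\<Sum>q | q permutes (A - {i}). (f (transpose i v \<circ> q) - m) * a i v) = N * a i v * a i v"
          by (simp flip: sum_distrib_right)
      qed
      finally show "(\<Sum>p\<in>P. (f p - m) * a i (p i)) = N * (\<Sum>v\<in>A. (a i v)\<^sup>2)"
        by (simp add: power2_eq_square sum_distrib_left mult.assoc)
    qed
    finally show ?thesis by (simp add: S_def)
  qed
  have LL: "(\<Sum>p\<in>P. (L p)\<^sup>2) \<le> n / (real n - 1) * S"
  proof -
    have "(\<Sum>p\<in>P. (L p)\<^sup>2) = (\<Sum>p\<in>P. \<Sum>i\<in>A. \<Sum>j\<in>A. a i (p i) * a j (p j))"
      by (simp add: L_def power2_eq_square sum_product)
    also have "\<dots> = (\<Sum>i\<in>A. \<Sum>j\<in>A. \<Sum>p\<in>P. a i (p i) * a j (p j))"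
      by (simp add: sum.swap[of _ _ P])
    \<comment> \<open>For \<open>i \<noteq> j\<close>, as \<open>a j\<close> has mean zero, only the
      excluded coincidences \<open>p i = p j\<close> remain, with a minus sign. The extra
      \<open>N'\<close> term on the diagonal lets the subtracted sum run over all pairs and become a
      sum of squares.\<close>
    also have "\<dots> = (\<Sum>i\<in>A. \<Sum>j\<in>A. (if j = i then N * (\<Sum>v\<in>A. (a i v)\<^sup>2) + N' * (\<Sum>v\<in>A. (a i v)\<^sup>2) else 0) - N' * (\<Sum>v\<in>A. a i v * a j v))"
    proof (intro sum.cong refl)
      fix i j assume ij: "i \<in> A" "j \<in> A"
      show "(\<Sum>p\<in>P. a i (p i) * a j (p j)) = (if j = i then N * (\<Sum>v\<in>A. (a i v)\<^sup>2) + N' * (\<Sum>v\<in>A. (a i v)\<^sup>2) else 0) - N' * (\<Sum>v\<in>A. a i v * a j v)"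
      proof (cases "j = i")
        case True
        then show ?thesis
          using sum_permutes_one_point[OF assms(1) ij(1), of "\<lambda>v. (a i v)\<^sup>2"] assms(2)
          by (simp add: P_def N_def power2_eq_square)
      next
        case False
        then show ?thesis
          using sum_permutes_two_points[OF assms(1) ij, of "a i" "a j"] assms(2) az[OF ij(2)]
          by (simp add: P_def N'_def sum_negf)
      qed
    qed
    also have "\<dots> = S + N' * (\<Sum>i\<in>A. \<Sum>v\<in>A. (a i v)\<^sup>2) - N' * (\<Sum>i\<in>A. \<Sum>j\<in>A. \<Sum>v\<in>A. a i v * a j v)"
      using assms(1) by (simp add: sum_subtractf S_def sum.distrib sum_distrib_left)
    also have "(\<Sum>i\<in>A. \<Sum>j\<in>A. \<Sum>v\<in>A. a i v * a j v) = (\<Sum>v\<in>A. (\<Sum>i\<in>A. a i v)\<^sup>2)"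
    proof -
      have "(\<Sum>i\<in>A. \<Sum>j\<in>A. \<Sum>v\<in>A. a i v * a j v) = (\<Sum>i\<in>A. \<Sum>v\<in>A. \<Sum>j\<in>A. a i v * a j v)"
        by (intro sum.cong refl sum.swap)
      also have "\<dots> = (\<Sum>v\<in>A. \<Sum>i\<in>A. \<Sum>j\<in>A. a i v * a j v)"
        by (rule sum.swap)
      finally show ?thesis by (simp add: power2_eq_square sum_product)
    qed
    also have "S + N' * (\<Sum>i\<in>A. \<Sum>v\<in>A. (a i v)\<^sup>2) - N' * (\<Sum>v\<in>A. (\<Sum>i\<in>A. a i v)\<^sup>2)
        \<le> S + N' * (\<Sum>i\<in>A. \<Sum>v\<in>A. (a i v)\<^sup>2)"
      using N by (simp add: sum_nonneg)
    also have "\<dots> = n / (real n - 1) * S"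
    proof -
      have S: "S = (real n - 1) * N' * (\<Sum>i\<in>A. \<Sum>v\<in>A. (a i v)\<^sup>2)"
        by (simp add: S_def N(3) flip: sum_distrib_left)
      show ?thesis
        unfolding S using assms(3) by (simp add: field_simps)
    qed
    finally show ?thesis .
  qed
  \<comment> \<open>This value minimises the quadratic bound in \<open>t\<close> reached
    below.\<close>
  define t where "t = (real n - 1) / n"
  have t: "t > 0" using assms(3) by (simp add: t_def)
  have V: "sum_var P f = (\<Sum>p\<in>P. (f p - m)\<^sup>2)"
    using sum_var_eq_sum_sq_dev[of P f] finP cP by (cases "P = {}") (auto simp: m_def P_def[symmetric])
  have "0 \<le> (\<Sum>p\<in>P. (f p - m - t * L p)\<^sup>2)" by (simp add: sum_nonneg)
  also have "\<dots> = sum_var P f - 2 * t * S + t\<^sup>2 * (\<Sum>p\<in>P. (L p)\<^sup>2)"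
  proof -
    have "(f p - m - t * L p)\<^sup>2 = (f p - m)\<^sup>2 - 2 * t * ((f p - m) * L p) + t\<^sup>2 * (L p)\<^sup>2" for p
      by (simp add: power2_eq_square algebra_simps)
    then show ?thesis
      by (simp add: V fL[symmetric] sum.distrib sum_subtractf sum_distrib_left)
  qed
  also have "\<dots> \<le> sum_var P f - 2 * t * S + t\<^sup>2 * (n / (real n - 1) * S)"
    using LL by (intro add_left_mono mult_left_mono) auto
  also have "t\<^sup>2 * (n / (real n - 1) * S) = t * S"
    using assms(3) by (simp add: t_def power2_eq_square field_simps)
  finally have "t * S \<le> sum_var P f" by (simp add: mult.commute)
  then have "S \<le> sum_var P f / t" using t by (simp add: field_simps)
  then show ?thesis using assms(3) by (simp add: S_def a_def P_def t_def N_def field_simps)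
qed

text \<open>Induction on \<open>n\<close>: conditioning on \<open>p i\<close> and summing over all
  \<open>i\<close> leaves the one-point variances, whose total is absorbed into the left-hand side.
  The constant is that of the spectral gap \<open>2 / n\<close> of random transpositions with
  \<open>i\<close> and \<open>j\<close> drawn independently, and the induction reproduces it
  exactly.\<close>

lemma permutes_poincare:
  fixes f :: "('a \<Rightarrow> 'a) \<Rightarrow> real"
  assumes "finite A" "card A = n"
  shows "sum_var {p. p permutes A} f
    \<le> 1 / (4 * n) * (\<Sum>i\<in>A. \<Sum>j\<in>A. \<Sum>p | p permutes A. (f p - f (p \<circ> transpose i j))\<^sup>2)"
  using assms
proof (induction n arbitrary: A f rule: less_induct)
  case (less n)
  \<comment> \<open>The case \<open>n = 2\<close> is separate because the inductive step ends by
    cancelling the factor \<open>n - 2\<close>.\<close>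
  consider "n \<le> 1" | "n = 2" | "n \<ge> 3" by linarith
  then show ?case
  proof cases
    case 1
    then have "card {p. p permutes A} = 1"
      using less.prems by (auto simp: card_permutations le_Suc_eq)
    then obtain p where "{p. p permutes A} = {p}" by (auto simp: card_Suc_eq)
    then have "sum_var {p. p permutes A} f = 0" by (simp add: sum_var_def)
    then show ?thesis by (simp add: sum_nonneg)
  next
    case 2
    then obtain a b where A: "A = {a, b}" "a \<noteq> b"
      using less.prems by (auto simp: card_2_iff)
    have neq: "id \<noteq> transpose a b" using A(2) by (metis id_apply transpose_apply_first)
    have P: "{p. p permutes A} = {id, transpose a b}"
      unfolding A by (auto simp: permutes_doubleton_iff)
    show ?thesis
      using 2 unfolding P using neq A
      by (simp add: sum_var_def transpose_commute[of b a] power2_eq_square field_simps flip: id_def)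
  next
    case 3
    define P where "P = {p. p permutes A}"
    define D where "D i j = (\<Sum>p\<in>P. (f p - f (p \<circ> transpose i j))\<^sup>2)" for i j
    define V where "V = sum_var P f"
    define B where "B = (\<Sum>i\<in>A. \<Sum>j\<in>A. D i j)"
    have D0: "D i i = 0" for i by (simp add: D_def)
    define b where "b i = (\<Sum>v\<in>A. ((\<Sum>q | q permutes (A - {i}). f (transpose i v \<circ> q)) / fact (n - 1) -
       (\<Sum>p | p permutes A. f p) / fact n)\<^sup>2)" for i
    \<comment> \<open>The induction hypothesis is applied inside each fibre \<open>p i = v\<close>:
      composing on the right with a transposition of points other than \<open>i\<close> stays in the
      fibre.\<close>
    have step: "V \<le> 1 / (4 * (real n - 1)) * (\<Sum>j\<in>A - {i}. \<Sum>l\<in>A - {i}. D j l) + fact (n - 1) * b i"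
      if i: "i \<in> A" for i
    proof -
      let ?Q = "{q. q permutes (A - {i})}"
      have "(\<Sum>v\<in>A. sum_var ?Q (\<lambda>q. f (transpose i v \<circ> q))) \<le>
          (\<Sum>v\<in>A. 1 / (4 * real (n - 1)) * (\<Sum>j\<in>A - {i}. \<Sum>l\<in>A - {i}. \<Sum>q\<in>?Q.
             (f (transpose i v \<circ> q) - f (transpose i v \<circ> (q \<circ> transpose j l)))\<^sup>2))"
        using less.prems i 3 by (intro sum_mono less.IH) auto
      also have "\<dots> = 1 / (4 * (real n - 1)) * (\<Sum>j\<in>A - {i}. \<Sum>l\<in>A - {i}. \<Sum>v\<in>A. \<Sum>q\<in>?Q.
             (f (transpose i v \<circ> q) - f (transpose i v \<circ> (q \<circ> transpose j l)))\<^sup>2)"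
        using 3 by (simp add: sum_distrib_left sum.swap[of _ _ A] of_nat_diff)
      also have "\<dots> = 1 / (4 * (real n - 1)) * (\<Sum>j\<in>A - {i}. \<Sum>l\<in>A - {i}. D j l)"
        unfolding D_def P_def sum_permutes_fix_value[OF less.prems(1) i] by (simp add: comp_assoc)
      finally show ?thesis
        unfolding V_def P_def b_def
        using sum_var_permutes_fix_value[OF less.prems(1) i, of f] less.prems(2) by simp
    qed
    \<comment> \<open>A pair \<open>j \<noteq> l\<close> is avoided by exactly \<open>n - 2\<close>
      choices of \<open>i\<close>, and \<open>D\<close> vanishes on the diagonal.\<close>
    have cnt: "(\<Sum>i\<in>A. \<Sum>j\<in>A - {i}. \<Sum>l\<in>A - {i}. D j l) = (real n - 2) * B"
    proof -
      have "(\<Sum>i\<in>A. \<Sum>j\<in>A - {i}. \<Sum>l\<in>A - {i}. D j l) =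
          (\<Sum>i\<in>A. \<Sum>j\<in>A. \<Sum>l\<in>A. if i \<in> A - {j, l} then D j l else 0)"
      proof (rule sum.cong[OF refl])
        fix i assume i: "i \<in> A"
        have "(\<Sum>j\<in>A. \<Sum>l\<in>A. if i \<in> A - {j, l} then D j l else 0) =
            (\<Sum>j\<in>A - {i}. \<Sum>l\<in>A. if i \<in> A - {j, l} then D j l else 0)"
          using less.prems by (intro sum.mono_neutral_right) auto
        also have "\<dots> = (\<Sum>j\<in>A - {i}. \<Sum>l\<in>A - {i}. if i \<in> A - {j, l} then D j l else 0)"
          using less.prems by (intro sum.cong refl sum.mono_neutral_right) auto
        also have "\<dots> = (\<Sum>j\<in>A - {i}. \<Sum>l\<in>A - {i}. D j l)"
          using i by (intro sum.cong refl) auto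
        finally show "(\<Sum>j\<in>A - {i}. \<Sum>l\<in>A - {i}. D j l) = (\<Sum>j\<in>A. \<Sum>l\<in>A. if i \<in> A - {j, l} then D j l else 0)" ..
      qed
      also have "\<dots> = (\<Sum>j\<in>A. \<Sum>l\<in>A. \<Sum>i\<in>A. if i \<in> A - {j, l} then D j l else 0)"
        by (subst sum.swap) (intro sum.cong refl sum.swap)
      also have "\<dots> = (\<Sum>j\<in>A. \<Sum>l\<in>A. (real n - 2) * D j l)"
      proof (intro sum.cong refl)
        fix j l assume jl: "j \<in> A" "l \<in> A"
        have "(\<Sum>i\<in>A. if i \<in> A - {j, l} then D j l else 0) = card (A - {j, l}) * D j l"
        proof -
          have "A \<inter> (A - {j, l}) = A - {j, l}" by auto
          then show ?thesis
            using less.prems(1) by (subst sum.inter_restrict[symmetric]) auto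
        qed
        also have "\<dots> = (real n - 2) * D j l"
          using jl less.prems 3 D0 by (cases "j = l") (auto simp: card_Diff_subset of_nat_diff)
        finally show "(\<Sum>i\<in>A. if i \<in> A - {j, l} then D j l else 0) = (real n - 2) * D j l" .
      qed
      finally show ?thesis by (simp add: B_def sum_distrib_left)
    qed
    have "n * V = (\<Sum>i\<in>A. V)" using less.prems by simp
    also have "\<dots> \<le> (\<Sum>i\<in>A. 1 / (4 * (real n - 1)) * (\<Sum>j\<in>A - {i}. \<Sum>l\<in>A - {i}. D j l) + fact (n - 1) * b i)"
      by (intro sum_mono step)
    also have "\<dots> = 1 / (4 * (real n - 1)) * ((real n - 2) * B) + (\<Sum>i\<in>A. fact (n - 1) * b i)"
      unfolding cnt[symmetric] by (simp add: sum.distrib sum_distrib_left)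
    also have "(\<Sum>i\<in>A. fact (n - 1) * b i) \<le> real n / (real n - 1) * V"
      unfolding V_def P_def b_def using less.prems 3 by (intro sum_one_point_variances_le) auto
    finally have "n * V \<le> ((real n - 2) * (B / 4) + n * V) / (real n - 1)"
      by (simp add: add_divide_distrib)
    then have "n * V * (real n - 1) \<le> (real n - 2) * (B / 4) + n * V"
      using 3 by (simp add: le_divide_eq)
    moreover have "(real n - 2) * (n * V) = n * V * (real n - 1) - n * V"
      by (simp add: algebra_simps)
    ultimately have "(real n - 2) * (n * V) \<le> (real n - 2) * (B / 4)"
      by linarith
    then have "n * V \<le> B / 4"
      using 3 by (subst (asm) mult_le_cancel_left_pos) auto
    then have "V \<le> 1 / (4 * real n) * B"
      using 3 by (simp add: field_simps)
    then show ?thesis unfolding V_def B_def D_def P_def .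
  qed
qed

section \<open>Tensorization\<close>

text \<open>For \<open>C\<close> uniform in \<open>Pow I\<close>, each coordinate makes the move
  \<open>g\<close> independently with probability 1/2. If \<open>g\<close> is an involution, this
  resamples every coordinate within its orbit.\<close>

definition apply_on :: "'c set \<Rightarrow> ('p \<Rightarrow> 'p) \<Rightarrow> ('c \<Rightarrow> 'p) \<Rightarrow> 'c \<Rightarrow> 'p" where
  "apply_on C g \<omega> = (\<lambda>c. if c \<in> C then g (\<omega> c) else \<omega> c)"

lemma sum_PiE_insert:
  assumes "x \<notin> I"
  shows "(\<Sum>\<omega>\<in>PiE (insert x I) S. F \<omega>) = (\<Sum>p\<in>S x. \<Sum>\<omega>\<in>PiE I S. F (\<omega>(x := p)))"
  unfolding PiE_insert_eq sum.cartesian_product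
  by (subst sum.reindex[OF inj_combinator[OF assms]]) (simp add: case_prod_unfold comp_def)

lemma sum_Pow_insert:
  assumes "x \<notin> I" "finite I"
  shows "(\<Sum>C\<in>Pow (insert x I). G C) = (\<Sum>C\<in>Pow I. G C + G (insert x C))"
proof -
  have "inj_on (insert x) (Pow I)" using assms(1) by (intro inj_onI) (auto simp: insert_ident)
  then show ?thesis
    unfolding Pow_insert using assms
    by (subst sum.union_disjoint) (auto simp: sum.reindex sum.distrib)
qed

lemma sum_apply_on:
  assumes "C \<subseteq> I" "\<And>p. p \<in> P \<Longrightarrow> t p \<in> P" "\<And>p. p \<in> P \<Longrightarrow> t (t p) = p"
  shows "(\<Sum>\<omega>\<in>PiE I (\<lambda>_. P). F (apply_on C t \<omega>)) = (\<Sum>\<omega>\<in>PiE I (\<lambda>_. P). F \<omega>)"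
  by (rule sum.reindex_bij_witness[of _ "apply_on C t" "apply_on C t"])
    (use assms in \<open>auto simp: apply_on_def PiE_iff extensional_def fun_eq_iff\<close>)

text \<open>Here \<open>p\<close> is one extra coordinate, and \<open>a\<close>, \<open>c\<close>
  are the function before and after the move in the other coordinates. The four squared differences
  between values of \<open>a\<close> and of \<open>c\<close> on the orbit of \<open>p\<close> split
  into a difference of orbit means and two inner differences. Cauchy-Schwarz then compares the orbit
  means with the total sums.\<close>

lemma sum_resample_ge:
  fixes a c :: "'p \<Rightarrow> real"
  assumes "finite P" "\<And>p. p \<in> P \<Longrightarrow> t p \<in> P" "\<And>p. p \<in> P \<Longrightarrow> t (t p) = p"
  shows "2 * ((\<Sum>p\<in>P. a p) - (\<Sum>p\<in>P. c p))\<^sup>2 / card P +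
      (\<Sum>p\<in>P. (a p - a (t p))\<^sup>2) / 2 + (\<Sum>p\<in>P. (c p - c (t p))\<^sup>2) / 2
    \<le> (\<Sum>p\<in>P. (a p - c p)\<^sup>2 + (a p - c (t p))\<^sup>2)"
proof -
  have re: "(\<Sum>p\<in>P. h (t p)) = (\<Sum>p\<in>P. h p)" for h :: "'p \<Rightarrow> real"
    by (rule sum.reindex_bij_witness[of _ t t]) (use assms in auto)
  define d where "d p = (a p + a (t p)) / 2 - (c p + c (t p)) / 2" for p
  have d: "(\<Sum>p\<in>P. d p) = (\<Sum>p\<in>P. a p) - (\<Sum>p\<in>P. c p)"
    unfolding d_def by (simp add: sum_subtractf sum.distrib re flip: sum_divide_distrib)
  \<comment> \<open>Symmetrising under \<open>t\<close> makes all four differences of the orbit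
    appear.\<close>
  have "(\<Sum>p\<in>P. (a p - c p)\<^sup>2 + (a p - c (t p))\<^sup>2) =
      (\<Sum>p\<in>P. (a p - c p)\<^sup>2 + (a p - c (t p))\<^sup>2 + (a (t p) - c (t p))\<^sup>2 + (a (t p) - c (t (t p)))\<^sup>2) / 2"
    using re[of "\<lambda>p. (a p - c p)\<^sup>2"] re[of "\<lambda>p. (a p - c (t p))\<^sup>2"] by (simp add: sum.distrib)
  also have "\<dots> = (\<Sum>p\<in>P. 2 * (d p)\<^sup>2 + (a p - a (t p))\<^sup>2 / 2 + (c p - c (t p))\<^sup>2 / 2)"
    unfolding sum_divide_distrib using assms(3)
    by (intro sum.cong refl) (simp add: d_def power2_eq_square field_simps)
  finally have eq: "(\<Sum>p\<in>P. (a p - c p)\<^sup>2 + (a p - c (t p))\<^sup>2) =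
      2 * (\<Sum>p\<in>P. (d p)\<^sup>2) + (\<Sum>p\<in>P. (a p - a (t p))\<^sup>2) / 2 + (\<Sum>p\<in>P. (c p - c (t p))\<^sup>2) / 2"
    by (simp add: sum.distrib sum_divide_distrib sum_distrib_left)
  have "(\<Sum>p\<in>P. d p)\<^sup>2 / card P \<le> (\<Sum>p\<in>P. (d p)\<^sup>2)"
    using sum_var_nonneg[OF assms(1), of d] by (simp add: sum_var_def)
  then show ?thesis unfolding eq d by simp
qed

text \<open>Resampling the swap independently in every coordinate is what keeps the constant
  independent of the number \<open>card I\<close> of coordinates.\<close>

lemma PiE_poincare:
  fixes f :: "('c \<Rightarrow> 'p) \<Rightarrow> real" and t :: "'e \<Rightarrow> 'p \<Rightarrow> 'p"
  assumes P: "finite P" "P \<noteq> {}" and K: "K \<ge> 0"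
    and t: "\<And>e p. e \<in> E \<Longrightarrow> p \<in> P \<Longrightarrow> t e p \<in> P" "\<And>e p. e \<in> E \<Longrightarrow> p \<in> P \<Longrightarrow> t e (t e p) = p"
    and base: "\<And>f. sum_var P f \<le> K / 2 * (\<Sum>e\<in>E. \<Sum>p\<in>P. (f p - f (t e p))\<^sup>2)"
    and I: "finite I"
  shows "sum_var (PiE I (\<lambda>_. P)) f
    \<le> K / 2 ^ card I * (\<Sum>e\<in>E. \<Sum>\<omega>\<in>PiE I (\<lambda>_. P). \<Sum>C\<in>Pow I. (f \<omega> - f (apply_on C (t e) \<omega>))\<^sup>2)"
  using I
proof (induction I arbitrary: f rule: finite_induct)
  case empty
  show ?case using K by (simp add: sum_var_def sum_nonneg)
next
  case (insert x I)
  define \<Omega> where "\<Omega> = PiE I (\<lambda>_. P)"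
  define M where "M = (2::real) ^ card I"
  define g where "g p \<omega> = f (\<omega>(x := p))" for p \<omega>
  define G where "G \<omega> = (\<Sum>p\<in>P. g p \<omega>)" for \<omega>
  define T where "T e \<omega> C = (\<Sum>p\<in>P. (g p \<omega> - g p (apply_on C (t e) \<omega>))\<^sup>2 + (g p \<omega> - g (t e p) (apply_on C (t e) \<omega>))\<^sup>2)" for e \<omega> C
  define U where "U e \<omega> = (\<Sum>p\<in>P. (g p \<omega> - g (t e p) \<omega>)\<^sup>2)" for e \<omega>
  define W where "W e = (\<Sum>\<omega>\<in>\<Omega>. \<Sum>C\<in>Pow I. (G \<omega> - G (apply_on C (t e) \<omega>))\<^sup>2)" for e
  have N: "real (card P) > 0" using P by (simp add: card_gt_0_iff)
  have M: "M > 0" by (simp add: M_def)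
  have fin: "finite \<Omega>" unfolding \<Omega>_def using insert.hyps P by (intro finite_PiE) auto
  have cP: "card (PiE (insert x I) (\<lambda>_. P)) = card P * card \<Omega>"
    using insert.hyps by (simp add: card_PiE \<Omega>_def)
  have cM: "2 ^ card (insert x I) = 2 * M" using insert.hyps by (simp add: M_def)
  \<comment> \<open>Total variance with coordinate \<open>x\<close> split off. \<open>G\<close> is a
    fibre sum rather than a fibre mean, hence the division by \<open>card P\<close>.\<close>
  have lhs: "sum_var (PiE (insert x I) (\<lambda>_. P)) f = (\<Sum>\<omega>\<in>\<Omega>. sum_var P (\<lambda>p. g p \<omega>)) + sum_var \<Omega> G / card P"
    unfolding sum_var_def cP sum_PiE_insert[OF insert.hyps(2)] \<Omega>_def[symmetric]
    by (simp add: g_def[symmetric] G_def sum_subtractf diff_divide_distrib mult.commute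
          sum.swap[of _ \<Omega> P] flip: sum_divide_distrib)
  have rhs: "(\<Sum>\<omega>\<in>PiE (insert x I) (\<lambda>_. P). \<Sum>C\<in>Pow (insert x I). (f \<omega> - f (apply_on C (t e) \<omega>))\<^sup>2)
      = (\<Sum>\<omega>\<in>\<Omega>. \<Sum>C\<in>Pow I. T e \<omega> C)" for e
  proof -
    have upd: "apply_on C (t e) (\<omega>(x := p)) = (apply_on C (t e) \<omega>)(x := p)"
      "apply_on (insert x C) (t e) (\<omega>(x := p)) = (apply_on C (t e) \<omega>)(x := t e p)"
      if "C \<in> Pow I" for C \<omega> p
      using that insert.hyps(2) by (auto simp: apply_on_def fun_eq_iff)
    have "(\<Sum>\<omega>\<in>PiE (insert x I) (\<lambda>_. P). \<Sum>C\<in>Pow (insert x I). (f \<omega> - f (apply_on C (t e) \<omega>))\<^sup>2)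
      = (\<Sum>p\<in>P. \<Sum>\<omega>\<in>\<Omega>. \<Sum>C\<in>Pow I. (g p \<omega> - g p (apply_on C (t e) \<omega>))\<^sup>2 + (g p \<omega> - g (t e p) (apply_on C (t e) \<omega>))\<^sup>2)"
      unfolding sum_PiE_insert[OF insert.hyps(2)] \<Omega>_def[symmetric] sum_Pow_insert[OF insert.hyps(2,1)]
      by (intro sum.cong refl) (simp add: upd g_def)
    also have "\<dots> = (\<Sum>\<omega>\<in>\<Omega>. \<Sum>C\<in>Pow I. T e \<omega> C)"
      unfolding T_def by (simp only: sum.swap[of _ P])
    finally show ?thesis .
  qed
  \<comment> \<open>One family of moves pays for both parts: \<open>W\<close> feeds the induction
    hypothesis on the other coordinates and \<open>U\<close> the one-coordinate inequality. Each
    move preserves the uniform measure, so the \<open>U\<close> terms before and after it have equal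
    totals.\<close>
  have T: "2 / card P * W e + M * (\<Sum>\<omega>\<in>\<Omega>. U e \<omega>) \<le> (\<Sum>\<omega>\<in>\<Omega>. \<Sum>C\<in>Pow I. T e \<omega> C)" if e: "e \<in> E" for e
  proof -
    have "(\<Sum>\<omega>\<in>\<Omega>. \<Sum>C\<in>Pow I. U e (apply_on C (t e) \<omega>)) = (\<Sum>C\<in>Pow I. \<Sum>\<omega>\<in>\<Omega>. U e (apply_on C (t e) \<omega>))"
      by (rule sum.swap)
    also have "\<dots> = (\<Sum>C\<in>Pow I. \<Sum>\<omega>\<in>\<Omega>. U e \<omega>)"
      unfolding \<Omega>_def using t e by (intro sum.cong refl sum_apply_on) auto
    also have "\<dots> = M * (\<Sum>\<omega>\<in>\<Omega>. U e \<omega>)"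
      using insert.hyps by (simp add: card_Pow M_def)
    finally have U: "(\<Sum>\<omega>\<in>\<Omega>. \<Sum>C\<in>Pow I. U e (apply_on C (t e) \<omega>)) = M * (\<Sum>\<omega>\<in>\<Omega>. U e \<omega>)" .
    have cPow: "real (card (Pow I)) = M"
      using insert.hyps by (simp add: card_Pow M_def)
    have "(\<Sum>\<omega>\<in>\<Omega>. \<Sum>C\<in>Pow I. 2 * (G \<omega> - G (apply_on C (t e) \<omega>))\<^sup>2 / card P + U e \<omega> / 2 + U e (apply_on C (t e) \<omega>) / 2)
        \<le> (\<Sum>\<omega>\<in>\<Omega>. \<Sum>C\<in>Pow I. T e \<omega> C)"
      unfolding T_def G_def U_def using P t e by (intro sum_mono sum_resample_ge) auto
    also have "(\<Sum>\<omega>\<in>\<Omega>. \<Sum>C\<in>Pow I. 2 * (G \<omega> - G (apply_on C (t e) \<omega>))\<^sup>2 / card P + U e \<omega> / 2 + U e (apply_on C (t e) \<omega>) / 2)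
       = 2 / card P * W e + M * (\<Sum>\<omega>\<in>\<Omega>. U e \<omega>)"
      unfolding W_def by (simp add: sum.distrib U cPow sum_distrib_left flip: sum_divide_distrib)
    finally show ?thesis .
  qed
  have "sum_var (PiE (insert x I) (\<lambda>_. P)) f
      \<le> (\<Sum>\<omega>\<in>\<Omega>. K / 2 * (\<Sum>e\<in>E. U e \<omega>)) + (K / M * (\<Sum>e\<in>E. W e)) / card P"
    unfolding lhs U_def W_def M_def \<Omega>_def
    using N by (intro add_mono sum_mono base divide_right_mono insert.IH) auto
  also have "\<dots> = K / (2 * M) * (\<Sum>e\<in>E. 2 / card P * W e + M * (\<Sum>\<omega>\<in>\<Omega>. U e \<omega>))"
  proof -
    have "(\<Sum>\<omega>\<in>\<Omega>. K / 2 * (\<Sum>e\<in>E. U e \<omega>)) = K / 2 * (\<Sum>e\<in>E. \<Sum>\<omega>\<in>\<Omega>. U e \<omega>)"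
      unfolding sum_distrib_left by (rule sum.swap)
    moreover have "(\<Sum>e\<in>E. 2 / card P * W e + M * (\<Sum>\<omega>\<in>\<Omega>. U e \<omega>)) =
        2 / card P * (\<Sum>e\<in>E. W e) + M * (\<Sum>e\<in>E. \<Sum>\<omega>\<in>\<Omega>. U e \<omega>)"
      by (simp only: sum.distrib sum_distrib_left)
    ultimately show ?thesis using M N by (simp add: field_simps)
  qed
  also have "\<dots> \<le> K / (2 * M) * (\<Sum>e\<in>E. \<Sum>\<omega>\<in>\<Omega>. \<Sum>C\<in>Pow I. T e \<omega> C)"
    using K M by (intro mult_left_mono sum_mono T) auto
  finally show ?case unfolding cM rhs .
qed

section \<open>Random perfect matchings\<close>

definition perm_tuples :: "nat \<Rightarrow> nat \<Rightarrow> (nat \<Rightarrow> nat \<Rightarrow> nat) set" where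
  "perm_tuples n k = PiE {1..k} (\<lambda>_. {p. p permutes {1..n}})"

text \<open>A family \<open>\<omega>\<close> of \<open>k\<close> permutations encodes the perfect matching of \<open>[n]\<^sup>k\<close> whose members are
  the tuples \<open>(\<omega> 1 t, \<dots>, \<omega> k t)\<close> for \<open>t \<in> [n]\<close>.\<close>

definition edge :: "nat \<Rightarrow> (nat \<Rightarrow> nat \<Rightarrow> nat) \<Rightarrow> nat \<Rightarrow> nat \<Rightarrow> nat" where
  "edge k \<omega> t = (\<lambda>c\<in>{1..k}. \<omega> c t)"

text \<open>Indices of tuples of the matching, rather than tuples, are collected;
  \<open>card (hits n k F \<omega>)\<close> is the number of matching tuples in
  \<open>F\<close>.\<close>

definition hits :: "nat \<Rightarrow> nat \<Rightarrow> (nat \<Rightarrow> nat) set \<Rightarrow> (nat \<Rightarrow> nat \<Rightarrow> nat) \<Rightarrow> nat set" where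
  "hits n k F \<omega> = {t\<in>{1..n}. edge k \<omega> t \<in> F}"

lemma finite_hits [simp]: "finite (hits n k F \<omega>)"
  by (simp add: hits_def)

lemma finite_perm_tuples [simp]: "finite (perm_tuples n k)"
  unfolding perm_tuples_def by (intro finite_PiE) (auto simp: finite_permutations)

lemma card_perm_tuples: "card (perm_tuples n k) = fact n ^ k"
  by (simp add: perm_tuples_def card_PiE card_permutations)

text \<open>Tensorization with \<open>K = 1 / (2 * n)\<close>, so that \<open>K / 2\<close> is the
  constant for a single permutation. The move exchanges the entries of two tuples of the matching in
  the coordinates in \<open>C\<close>.\<close>

lemma perm_tuples_poincare:
  assumes "n \<ge> 1"
  shows "sum_var (perm_tuples n k) f \<le> 1 / (2 * real n * 2 ^ k) * (\<Sum>e\<in>{1..n} \<times> {1..n}. \<Sum>\<omega>\<in>perm_tuples n k.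
    \<Sum>C\<in>Pow {1..k}. (f \<omega> - f (apply_on C (\<lambda>p. p \<circ> transpose (fst e) (snd e)) \<omega>))\<^sup>2)"
proof -
  let ?P = "{p. p permutes {1..n}}"
  have "sum_var ?P g \<le> (1 / (2 * n)) / 2 *
      (\<Sum>e\<in>{1..n} \<times> {1..n}. \<Sum>p\<in>?P. (g p - g (p \<circ> transpose (fst e) (snd e)))\<^sup>2)" for g
    using permutes_poincare[of "{1..n}" n g] by (simp add: sum.cartesian_product[where A="{1..n}" and B="{1..n}"] case_prod_unfold del: One_nat_def)
  moreover have "?P \<noteq> {}" using permutes_id[of "{1..n}"] by blast
  ultimately have "sum_var (PiE {1..k} (\<lambda>_. ?P)) f \<le> (1 / (2 * n)) / 2 ^ card {1..k} *
      (\<Sum>e\<in>{1..n} \<times> {1..n}. \<Sum>\<omega>\<in>PiE {1..k} (\<lambda>_. ?P).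
    \<Sum>C\<in>Pow {1..k}. (f \<omega> - f (apply_on C (\<lambda>p. p \<circ> transpose (fst e) (snd e)) \<omega>))\<^sup>2)"
    by (intro PiE_poincare)
      (auto simp: finite_permutations permutes_compose permutes_swap_id comp_assoc)
  then show ?thesis by (simp add: perm_tuples_def)
qed

lemma hits_apply_on_subset:
  "hits n k F \<omega> \<subseteq> hits n k F (apply_on C (\<lambda>p. p \<circ> transpose i j) \<omega>) \<union> ({i, j} \<inter> hits n k F \<omega>)"
proof
  fix t assume t: "t \<in> hits n k F \<omega>"
  show "t \<in> hits n k F (apply_on C (\<lambda>p. p \<circ> transpose i j) \<omega>) \<union> ({i, j} \<inter> hits n k F \<omega>)"
  proof (cases "t \<in> {i, j}")
    case False
    then have "edge k (apply_on C (\<lambda>p. p \<circ> transpose i j) \<omega>) t = edge k \<omega> t"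
      by (auto simp: edge_def apply_on_def fun_eq_iff transpose_def)
    then show ?thesis using t by (simp add: hits_def)
  qed (use t in auto)
qed

lemma card_hits_apply_on:
  "card (hits n k F \<omega>) \<le> card (hits n k F (apply_on C (\<lambda>p. p \<circ> transpose i j) \<omega>)) + card ({i, j} \<inter> hits n k F \<omega>)"
  by (rule order_trans[OF card_mono[OF _ hits_apply_on_subset] card_Un_le]) auto

text \<open>Every change is charged to the configuration with more hits; its count lies in
  \<open>S\<close>, and one of the two moved tuples is a hit there. A change is at most 2, so its
  square is at most 4. Each hit occurs in \<open>2 * n\<close> positions of ordered pairs, and
  either end of a move may pay; with the factor \<open>1 / (2 * n)\<close> this gives 8.\<close>

lemma sum_var_card_hits:
  fixes \<phi> :: "nat \<Rightarrow> real"
  assumes n: "n \<ge> 1"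
    and lip: "\<And>x y. \<bar>\<phi> x - \<phi> y\<bar> \<le> \<bar>real x - real y\<bar>"
    and S: "\<And>x y. y < x \<Longrightarrow> x \<le> y + 2 \<Longrightarrow> \<phi> x \<noteq> \<phi> y \<Longrightarrow> x \<in> S"
  shows "sum_var (perm_tuples n k) (\<lambda>\<omega>. \<phi> (card (hits n k F \<omega>))) \<le>
    8 * (\<Sum>\<omega>\<in>perm_tuples n k. if card (hits n k F \<omega>) \<in> S then real (card (hits n k F \<omega>)) else 0)"
proof -
  define \<Omega> where "\<Omega> = perm_tuples n k"
  define H where "H \<omega> = hits n k F \<omega>" for \<omega>
  define R where "R e C = apply_on C (\<lambda>p. p \<circ> transpose (fst e) (snd e) :: nat \<Rightarrow> nat)" for e :: "nat \<times> nat" and C :: "nat set"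
  define b where "b e \<omega> = (if card (H \<omega>) \<in> S then 4 * (of_bool (fst e \<in> H \<omega>) + of_bool (snd e \<in> H \<omega>)) else (0::real))" for e \<omega>
  have b0: "b e \<omega> \<ge> 0" for e \<omega> by (simp add: b_def)
  have RR: "R e C (R e C \<omega>) = \<omega>" for e C \<omega>
    by (simp add: R_def apply_on_def fun_eq_iff)
  have low: "(\<phi> (card (H \<omega>)) - \<phi> (card (H (R e C \<omega>))))\<^sup>2 \<le> b e \<omega>"
    if "card (H (R e C \<omega>)) < card (H \<omega>)" for e C \<omega>
  proof (cases "\<phi> (card (H \<omega>)) = \<phi> (card (H (R e C \<omega>)))")
    case True
    then show ?thesis using b0 by simp
  next
    case False
    have c: "card (H \<omega>) \<le> card (H (R e C \<omega>)) + card ({fst e, snd e} \<inter> H \<omega>)"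
      unfolding H_def R_def by (rule card_hits_apply_on)
    have "card ({fst e, snd e} \<inter> H \<omega>) \<le> card {fst e, snd e}"
      by (rule card_mono) auto
    also have "\<dots> \<le> 2" by (cases "fst e = snd e") auto
    finally have le2: "card (H \<omega>) \<le> card (H (R e C \<omega>)) + 2" using c by linarith
    have "card (H \<omega>) \<in> S" using S[OF that le2 False] .
    \<comment> \<open>The count can drop only if a moved tuple was a hit.\<close>
    moreover have "{fst e, snd e} \<inter> H \<omega> \<noteq> {}" using c that by (metis add_0_right card.empty not_less)
    ultimately have "b e \<omega> \<ge> 4" by (auto simp: b_def)
    moreover have "\<bar>\<phi> (card (H \<omega>)) - \<phi> (card (H (R e C \<omega>)))\<bar> \<le> 2"
      using lip[of "card (H \<omega>)" "card (H (R e C \<omega>))"] that le2 by linarith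
    then have "(\<phi> (card (H \<omega>)) - \<phi> (card (H (R e C \<omega>))))\<^sup>2 \<le> 4"
      using abs_le_square_iff[of "\<phi> (card (H \<omega>)) - \<phi> (card (H (R e C \<omega>)))" 2] by simp
    ultimately show ?thesis by linarith
  qed
  have pt: "(\<phi> (card (H \<omega>)) - \<phi> (card (H (R e C \<omega>))))\<^sup>2 \<le> b e \<omega> + b e (R e C \<omega>)" for e C \<omega>
  proof -
    consider "card (H (R e C \<omega>)) < card (H \<omega>)" | "card (H (R e C \<omega>)) = card (H \<omega>)"
      | "card (H \<omega>) < card (H (R e C \<omega>))" by linarith
    then show ?thesis
    proof cases
      case 1
      then show ?thesis using low[OF 1] b0[of e "R e C \<omega>"] by linarith
    next
      case 2
      then show ?thesis using b0 by simp
    next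
      case 3
      then show ?thesis using low[of e C "R e C \<omega>"] b0[of e \<omega>] by (simp add: RR power2_commute)
    qed
  qed
  have e: "(\<Sum>\<omega>\<in>\<Omega>. \<Sum>C\<in>Pow {1..k}. (\<phi> (card (H \<omega>)) - \<phi> (card (H (R e C \<omega>))))\<^sup>2) \<le> 2 ^ k * (2 * (\<Sum>\<omega>\<in>\<Omega>. b e \<omega>))"
    if e: "e \<in> {1..n} \<times> {1..n}" for e
  proof -
    have "(\<Sum>\<omega>\<in>\<Omega>. \<Sum>C\<in>Pow {1..k}. (\<phi> (card (H \<omega>)) - \<phi> (card (H (R e C \<omega>))))\<^sup>2)
        = (\<Sum>C\<in>Pow {1..k}. \<Sum>\<omega>\<in>\<Omega>. (\<phi> (card (H \<omega>)) - \<phi> (card (H (R e C \<omega>))))\<^sup>2)"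
      by (rule sum.swap)
    also have "\<dots> \<le> (\<Sum>C\<in>Pow {1..k}. \<Sum>\<omega>\<in>\<Omega>. b e \<omega> + b e (R e C \<omega>))"
      by (intro sum_mono pt)
    also have "\<dots> = (\<Sum>C\<in>Pow {1..k}. (\<Sum>\<omega>\<in>\<Omega>. b e \<omega>) + (\<Sum>\<omega>\<in>\<Omega>. b e \<omega>))"
    proof (rule sum.cong[OF refl])
      fix C assume C: "C \<in> Pow {1..k}"
      have "(\<Sum>\<omega>\<in>\<Omega>. b e (R e C \<omega>)) = (\<Sum>\<omega>\<in>\<Omega>. b e \<omega>)"
        unfolding \<Omega>_def perm_tuples_def R_def
      proof (rule sum_apply_on)
        show "C \<subseteq> {1..k}" using C by simp
        show "p \<circ> transpose (fst e) (snd e) \<in> {p. p permutes {1..n}}" if "p \<in> {p. p permutes {1..n}}" for p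
          using that e permutes_compose[OF permutes_swap_id, of "fst e" "{1..n}" "snd e" p] by auto
      qed (simp add: comp_assoc)
      then show "(\<Sum>\<omega>\<in>\<Omega>. b e \<omega> + b e (R e C \<omega>)) = (\<Sum>\<omega>\<in>\<Omega>. b e \<omega>) + (\<Sum>\<omega>\<in>\<Omega>. b e \<omega>)"
        by (simp add: sum.distrib)
    qed
    also have "\<dots> = 2 ^ k * (2 * (\<Sum>\<omega>\<in>\<Omega>. b e \<omega>))" by (simp add: card_Pow)
    finally show ?thesis .
  qed
  have cnt: "(\<Sum>e\<in>{1..n} \<times> {1..n}. b e \<omega>) = 8 * n * (if card (H \<omega>) \<in> S then real (card (H \<omega>)) else 0)" for \<omega>
  proof -
    have HI: "{1..n} \<inter> H \<omega> = H \<omega>" by (auto simp: H_def hits_def)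
    have "(\<Sum>i\<in>{1..n}. \<Sum>j\<in>{1..n}. 4 * (of_bool (i \<in> H \<omega>) + of_bool (j \<in> H \<omega>))) = (8 * n * card (H \<omega>) :: real)"
      by (simp add: sum.distrib of_bool_def HI del: One_nat_def flip: sum_distrib_left sum.inter_restrict)
    then show ?thesis
      by (simp add: b_def sum.cartesian_product case_prod_unfold)
  qed
  have "sum_var \<Omega> (\<lambda>\<omega>. \<phi> (card (H \<omega>))) \<le> 1 / (2 * real n * 2 ^ k) * (\<Sum>e\<in>{1..n} \<times> {1..n}. \<Sum>\<omega>\<in>\<Omega>.
      \<Sum>C\<in>Pow {1..k}. (\<phi> (card (H \<omega>)) - \<phi> (card (H (R e C \<omega>))))\<^sup>2)"
    unfolding \<Omega>_def R_def by (rule perm_tuples_poincare[OF n])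
  also have "\<dots> \<le> 1 / (2 * real n * 2 ^ k) * (\<Sum>e\<in>{1..n} \<times> {1..n}. 2 ^ k * (2 * (\<Sum>\<omega>\<in>\<Omega>. b e \<omega>)))"
    by (intro mult_left_mono sum_mono e) auto
  also have "\<dots> = 1 / n * (\<Sum>\<omega>\<in>\<Omega>. \<Sum>e\<in>{1..n} \<times> {1..n}. b e \<omega>)"
    by (simp add: sum.swap[of _ \<Omega>] flip: sum_distrib_left)
  also have "\<dots> = 8 * (\<Sum>\<omega>\<in>\<Omega>. if card (H \<omega>) \<in> S then real (card (H \<omega>)) else 0)"
    unfolding cnt using n by (simp flip: sum_distrib_left)
  finally show ?thesis unfolding \<Omega>_def H_def .
qed

section \<open>The mean number of hits\<close>

lemma card_permutes_fix_value:
  assumes "finite A" "i \<in> A" "v \<in> A"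
  shows "card {p. p permutes A \<and> p i = v} = fact (card A - 1)"
proof -
  have "real (card {p. p permutes A \<and> p i = v}) = (\<Sum>p | p permutes A. of_bool (p i = v))"
    using assms by (simp add: finite_permutations Collect_conj_eq)
  also have "\<dots> = fact (card A - 1)"
    using sum_permutes_one_point[OF assms(1,2), of "\<lambda>w. of_bool (w = v)"] assms by (simp add: of_bool_def)
  finally have "real (card {p. p permutes A \<and> p i = v}) = real (fact (card A - 1))" by simp
  then show ?thesis by (simp only: of_nat_eq_iff)
qed

text \<open>Double counting: a given tuple sits at a given index in \<open>fact (n - 1) ^ k\<close>
  of the matchings, the coordinates being independent. For \<open>n, k \<ge> 1\<close> the mean is
  thus \<open>card F / n ^ (k - 1)\<close>.\<close>

lemma sum_card_hits:
  assumes F: "F \<subseteq> tuples n k"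
  shows "(\<Sum>\<omega>\<in>perm_tuples n k. card (hits n k F \<omega>)) = card F * n * fact (n - 1) ^ k"
proof -
  have finF: "finite F" using F unfolding tuples_def by (rule finite_subset) (simp add: finite_PiE)
  have cnt: "card (perm_tuples n k \<inter> {\<omega>. edge k \<omega> t = f}) = fact (n - 1) ^ k"
    if "t \<in> {1..n}" "f \<in> F" for t f
  proof -
    have f: "f \<in> {1..k} \<rightarrow>\<^sub>E {1..n}" using that F by (auto simp: tuples_def)
    have "perm_tuples n k \<inter> {\<omega>. edge k \<omega> t = f} = PiE {1..k} (\<lambda>c. {p. p permutes {1..n} \<and> p t = f c})"
      using f by (auto simp: perm_tuples_def edge_def PiE_iff extensional_def fun_eq_iff restrict_def)
    also have "card (PiE {1..k} (\<lambda>c. {p. p permutes {1..n} \<and> p t = f c})) = (\<Prod>c\<in>{1..k}. card {p. p permutes {1..n} \<and> p t = f c})"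
      by (simp add: card_PiE)
    also have "\<dots> = (\<Prod>c\<in>{1..k}. fact (n - 1))"
      using f that by (intro prod.cong refl card_permutes_fix_value[THEN trans]) (auto simp: PiE_iff)
    finally show ?thesis by simp
  qed
  have "card (hits n k F \<omega>) = (\<Sum>t\<in>{1..n}. \<Sum>f\<in>F. of_bool (edge k \<omega> t = f))" for \<omega>
  proof -
    have "hits n k F \<omega> = {1..n} \<inter> {t. edge k \<omega> t \<in> F}" by (auto simp: hits_def)
    moreover have "(\<Sum>f\<in>F. of_bool (edge k \<omega> t = f)) = (of_bool (edge k \<omega> t \<in> F) :: nat)" for t
      using finF by (simp add: of_bool_def)
    ultimately show ?thesis by (simp del: One_nat_def)
  qed
  then have "(\<Sum>\<omega>\<in>perm_tuples n k. card (hits n k F \<omega>)) =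
      (\<Sum>\<omega>\<in>perm_tuples n k. \<Sum>t\<in>{1..n}. \<Sum>f\<in>F. of_bool (edge k \<omega> t = f))"
    by simp
  also have "\<dots> = (\<Sum>t\<in>{1..n}. \<Sum>f\<in>F. \<Sum>\<omega>\<in>perm_tuples n k. of_bool (edge k \<omega> t = f))"
    by (simp only: sum.swap[of _ "perm_tuples n k"])
  also have "\<dots> = (\<Sum>t\<in>{1..n}. \<Sum>f\<in>F. fact (n - 1) ^ k)"
    by (intro sum.cong refl) (simp add: cnt del: One_nat_def)
  finally show ?thesis by simp
qed

section \<open>Relative concentration and rainbow matchings\<close>

text \<open>By Cauchy-Schwarz on the support of \<open>h\<close>, which is at most half of
  \<open>A\<close>, the squared mean is at most half the mean square.\<close>

lemma sum_sq_le_sum_var: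
  fixes h :: "'a \<Rightarrow> real"
  assumes "finite A" "2 * card {x\<in>A. h x \<noteq> 0} \<le> card A"
  shows "(\<Sum>x\<in>A. (h x)\<^sup>2) \<le> 2 * sum_var A h"
proof -
  let ?B = "{x\<in>A. h x \<noteq> 0}"
  have s: "(\<Sum>x\<in>?B. h x) = (\<Sum>x\<in>A. h x)" "(\<Sum>x\<in>?B. (h x)\<^sup>2) = (\<Sum>x\<in>A. (h x)\<^sup>2)"
    using assms(1) by (auto intro!: sum.mono_neutral_left)
  show ?thesis
  proof (cases "card ?B = 0")
    case True
    then have "\<forall>x\<in>A. h x = 0" using assms(1) by auto
    then show ?thesis by (simp add: sum_var_def)
  next
    case False
    then have pos: "real (card ?B) > 0" "real (card A) > 0" using assms(2) by linarith+
    have "(\<Sum>x\<in>A. h x)\<^sup>2 / card ?B \<le> (\<Sum>x\<in>A. (h x)\<^sup>2)"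
      using sum_var_nonneg[of ?B h] assms(1) by (simp add: sum_var_def s)
    then have "(\<Sum>x\<in>A. h x)\<^sup>2 \<le> card ?B * (\<Sum>x\<in>A. (h x)\<^sup>2)"
      using pos by (simp add: divide_le_eq mult.commute)
    also have "\<dots> \<le> card A / 2 * (\<Sum>x\<in>A. (h x)\<^sup>2)"
      using assms(2) by (intro mult_right_mono sum_nonneg) auto
    finally have "(\<Sum>x\<in>A. h x)\<^sup>2 / card A \<le> (\<Sum>x\<in>A. (h x)\<^sup>2) / 2"
      using pos by (simp add: field_simps)
    moreover have "a \<le> 2 * (a - b)" if "b \<le> a / 2" for a b :: real
      using that by simp
    ultimately show ?thesis unfolding sum_var_def by blast
  qed
qed

lemma markov_card:
  fixes h :: "'a \<Rightarrow> real"
  assumes "finite A" "\<And>x. x \<in> A \<Longrightarrow> h x \<ge> 0" "\<And>x. x \<in> A \<Longrightarrow> Q x \<Longrightarrow> h x \<ge> c"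
  shows "c * card {x\<in>A. Q x} \<le> (\<Sum>x\<in>A. h x)"
proof -
  have "c * card {x\<in>A. Q x} = (\<Sum>x\<in>{x\<in>A. Q x}. c)" by simp
  also have "\<dots> \<le> (\<Sum>x\<in>{x\<in>A. Q x}. h x)" using assms by (intro sum_mono) auto
  also have "\<dots> \<le> (\<Sum>x\<in>A. h x)" using assms by (intro sum_mono2) auto
  finally show ?thesis .
qed

text \<open>The tails are bounded relative to \<open>\<Sum>\<bar>y\<bar>\<close>, not absolutely: \<open>\<Sum>y\<close> may be
  arbitrarily small, and this is what allows truncating \<open>y\<close> without losing its positive mean.\<close>

lemma relative_concentration:
  fixes X :: "'a \<Rightarrow> nat" and s :: nat and y :: "'a \<Rightarrow> real"
  assumes fin: "finite \<Omega>"
    and s: "s \<ge> 10 ^ 9"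
    and var: "\<And>\<phi> S. (\<And>x y. \<bar>\<phi> x - \<phi> y\<bar> \<le> \<bar>real x - real y\<bar>) \<Longrightarrow>
      (\<And>x y. y < x \<Longrightarrow> x \<le> y + 2 \<Longrightarrow> \<phi> x \<noteq> \<phi> y \<Longrightarrow> x \<in> S) \<Longrightarrow>
      sum_var \<Omega> (\<lambda>\<omega>. \<phi> (X \<omega>)) \<le> 8 * (\<Sum>\<omega>\<in>\<Omega>. if X \<omega> \<in> S then real (X \<omega>) else 0)"
  defines "y \<equiv> \<lambda>\<omega>. real (X \<omega>) - (real s - 1)"
  assumes mean: "0 < (\<Sum>\<omega>\<in>\<Omega>. y \<omega>)" "(\<Sum>\<omega>\<in>\<Omega>. y \<omega>) \<le> card \<Omega>"
  shows "4 / 3 * (\<Sum>\<omega>\<in>\<Omega>. max 0 (y \<omega> - s / 4)) + (real s)\<^sup>2 * card {\<omega>\<in>\<Omega>. y \<omega> < - (s / 2)}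
    \<le> (\<Sum>\<omega>\<in>\<Omega>. \<bar>y \<omega>\<bar>) / 3"
proof -
  define m where "m = (\<Sum>\<omega>\<in>\<Omega>. \<bar>y \<omega>\<bar>)"
  define N where "N = real (card \<Omega>)"
  have m0: "m \<ge> 0" by (simp add: m_def sum_nonneg)
  have "real (10 ^ 9) \<le> real s" using s by (simp only: of_nat_le_iff)
  then have s': "real s \<ge> 10 ^ 9" by simp
  have N: "N > 0" using mean(1) fin by (auto simp: N_def card_gt_0_iff)
  have X: "real (X \<omega>) = y \<omega> + (real s - 1)" for \<omega> by (simp add: y_def)
  have sumX: "(\<Sum>\<omega>\<in>\<Omega>. real (X \<omega>)) = (\<Sum>\<omega>\<in>\<Omega>. y \<omega>) + N * (real s - 1)"
    by (simp add: y_def sum_subtractf N_def)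
  \<comment> \<open>A crude second moment bound, from \<open>var\<close> for the identity; it serves
    only to show that \<open>\<bar>y \<omega>\<bar> \<ge> s / 8\<close> is rare.\<close>
  have second: "(\<Sum>\<omega>\<in>\<Omega>. (y \<omega>)\<^sup>2) \<le> 9 * s * N"
  proof -
    have "sum_var \<Omega> (\<lambda>\<omega>. real (X \<omega>)) \<le> 8 * (\<Sum>\<omega>\<in>\<Omega>. real (X \<omega>))"
      using var[of real UNIV] by simp
    also have "\<dots> \<le> 8 * (s * N)"
      using mean(2) unfolding sumX N_def[symmetric] by (simp add: algebra_simps)
    finally have v: "sum_var \<Omega> (\<lambda>\<omega>. real (X \<omega>)) \<le> 8 * (s * N)" .
    have "(\<Sum>\<omega>\<in>\<Omega>. (y \<omega>)\<^sup>2) = sum_var \<Omega> (\<lambda>\<omega>. real (X \<omega>)) + (\<Sum>\<omega>\<in>\<Omega>. y \<omega>)\<^sup>2 / N"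
    proof -
      define Y where "Y = (\<Sum>\<omega>\<in>\<Omega>. y \<omega>)"
      define Q where "Q = (\<Sum>\<omega>\<in>\<Omega>. (real (X \<omega>))\<^sup>2)"
      have 1: "(\<Sum>\<omega>\<in>\<Omega>. (y \<omega>)\<^sup>2) = Q - 2 * (real s - 1) * (Y + N * (real s - 1)) + N * (real s - 1)\<^sup>2"
        using sum_sq_dev[OF fin, of "\<lambda>\<omega>. real (X \<omega>)" "real s - 1"]
        unfolding sumX Q_def Y_def N_def y_def .
      have 2: "sum_var \<Omega> (\<lambda>\<omega>. real (X \<omega>)) = Q - (Y + N * (real s - 1))\<^sup>2 / N"
        unfolding sum_var_def sumX Q_def Y_def N_def ..
      show ?thesis
        unfolding 1 2 Y_def[symmetric] using N by (simp add: field_simps power2_eq_square)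
    qed
    moreover have "(\<Sum>\<omega>\<in>\<Omega>. y \<omega>)\<^sup>2 \<le> N\<^sup>2"
      using mean by (intro power_mono) (auto simp: N_def)
    then have "(\<Sum>\<omega>\<in>\<Omega>. y \<omega>)\<^sup>2 / N \<le> N"
      using N by (simp add: divide_le_eq power2_eq_square)
    moreover have "N \<le> s * N" using N s' by simp
    ultimately show ?thesis using v by linarith
  qed
  \<comment> \<open>Chebyshev's inequality. It lets mean squares of tail functions be bounded by
    their variances.\<close>
  have rare: "2 * card {\<omega>\<in>\<Omega>. \<phi> (X \<omega>) \<noteq> 0} \<le> card \<Omega>"
    if "\<And>\<omega>. \<phi> (X \<omega>) \<noteq> 0 \<Longrightarrow> \<bar>y \<omega>\<bar> \<ge> s / 8" for \<phi> :: "nat \<Rightarrow> real"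
  proof -
    have "(s / 8)\<^sup>2 * card {\<omega>\<in>\<Omega>. \<phi> (X \<omega>) \<noteq> 0} \<le> (\<Sum>\<omega>\<in>\<Omega>. (y \<omega>)\<^sup>2)"
    proof (rule markov_card[OF fin])
      show "(s / 8)\<^sup>2 \<le> (y \<omega>)\<^sup>2" if "\<phi> (X \<omega>) \<noteq> 0" for \<omega>
        using \<open>\<And>\<omega>. \<phi> (X \<omega>) \<noteq> 0 \<Longrightarrow> \<bar>y \<omega>\<bar> \<ge> s / 8\<close>[OF that] by (simp flip: abs_le_square_iff)
    qed auto
    also note second
    finally have "s * (s * card {\<omega>\<in>\<Omega>. \<phi> (X \<omega>) \<noteq> 0}) \<le> s * (576 * N)"
      by (simp add: power2_eq_square)
    then have "s * real (card {\<omega>\<in>\<Omega>. \<phi> (X \<omega>) \<noteq> 0}) \<le> 576 * N"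
      using s' by (simp add: mult_le_cancel_left_pos)
    moreover have "1152 * real (card {\<omega>\<in>\<Omega>. \<phi> (X \<omega>) \<noteq> 0}) \<le> s * real (card {\<omega>\<in>\<Omega>. \<phi> (X \<omega>) \<noteq> 0})"
      using s' by (intro mult_right_mono) auto
    ultimately have "real (2 * card {\<omega>\<in>\<Omega>. \<phi> (X \<omega>) \<noteq> 0}) \<le> real (card \<Omega>)"
      by (simp add: N_def)
    then show ?thesis by (simp only: of_nat_le_iff)
  qed
  have tail: "(\<Sum>\<omega>\<in>\<Omega>. (\<phi> (X \<omega>))\<^sup>2) \<le> 16 * (\<Sum>\<omega>\<in>\<Omega>. if X \<omega> \<in> S then real (X \<omega>) else 0)"
    if "\<And>x y. \<bar>\<phi> x - \<phi> y\<bar> \<le> \<bar>real x - real y\<bar>"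
      "\<And>x y. y < x \<Longrightarrow> x \<le> y + 2 \<Longrightarrow> \<phi> x \<noteq> \<phi> y \<Longrightarrow> x \<in> S"
      "\<And>\<omega>. \<phi> (X \<omega>) \<noteq> 0 \<Longrightarrow> \<bar>y \<omega>\<bar> \<ge> s / 8" for \<phi> S
  proof -
    have "(\<Sum>\<omega>\<in>\<Omega>. (\<phi> (X \<omega>))\<^sup>2) \<le> 2 * sum_var \<Omega> (\<lambda>\<omega>. \<phi> (X \<omega>))"
      by (rule sum_sq_le_sum_var[OF fin rare]) (rule that(3))
    also have "sum_var \<Omega> (\<lambda>\<omega>. \<phi> (X \<omega>)) \<le> 8 * (\<Sum>\<omega>\<in>\<Omega>. if X \<omega> \<in> S then real (X \<omega>) else 0)"
      by (rule var) (rule that(1), rule that(2))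
    finally show ?thesis by simp
  qed
  have upper: "(\<Sum>\<omega>\<in>\<Omega>. max 0 (y \<omega> - s / 4)) \<le> 1152 * m / s"
  proof -
    define \<phi> where "\<phi> x = max 0 (real x - (real s - 1) - s / 8)" for x :: nat
    have "(\<Sum>\<omega>\<in>\<Omega>. (\<phi> (X \<omega>))\<^sup>2) \<le> 16 * (\<Sum>\<omega>\<in>\<Omega>. if X \<omega> \<in> {x. real x > real s - 1 + s / 8} then real (X \<omega>) else 0)"
      by (rule tail) (auto simp: \<phi>_def y_def max_def split: if_splits)
    \<comment> \<open>Where \<open>y \<omega> > s / 8\<close>,
      \<open>X \<omega> = y \<omega> + (s - 1) < 9 * y \<omega>\<close>.\<close>
    also have "\<dots> \<le> 16 * (\<Sum>\<omega>\<in>\<Omega>. 9 * \<bar>y \<omega>\<bar>)"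
      by (intro mult_left_mono sum_mono) (auto simp: y_def)
    finally have 1: "(\<Sum>\<omega>\<in>\<Omega>. (\<phi> (X \<omega>))\<^sup>2) \<le> 144 * m"
      by (simp add: m_def flip: sum_distrib_left)
    have "max 0 (y \<omega> - s / 4) \<le> 8 / s * (\<phi> (X \<omega>))\<^sup>2" for \<omega>
    proof (cases "y \<omega> \<le> s / 4")
      case False
      define d where "d = \<phi> (X \<omega>)"
      have d: "d = y \<omega> - s / 8" "s / 8 \<le> d" using False by (auto simp: d_def \<phi>_def y_def)
      have "s / 8 * d \<le> d * d" using d(2) by (intro mult_right_mono) auto
      then have "d \<le> 8 / s * d\<^sup>2" using s' by (simp add: field_simps power2_eq_square)
      then show ?thesis using d False s' unfolding d_def[symmetric] by linarith
    qed auto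
    then have "(\<Sum>\<omega>\<in>\<Omega>. max 0 (y \<omega> - s / 4)) \<le> (\<Sum>\<omega>\<in>\<Omega>. 8 / s * (\<phi> (X \<omega>))\<^sup>2)"
      by (rule sum_mono)
    also have "\<dots> \<le> 8 / s * (144 * m)"
      unfolding sum_distrib_left[symmetric] using 1 by (intro mult_left_mono) auto
    finally show ?thesis by simp
  qed
  define c where "c b = real (card {\<omega>\<in>\<Omega>. y \<omega> < - b})" for b
  \<comment> \<open>The threshold moves to \<open>b - 2\<close> because \<open>S\<close> must
    contain the larger of two counts differing by at most 2, of which only the smaller need lie in
    the support of \<open>\<phi>\<close>.\<close>
  have lower: "d\<^sup>2 * c (b + d) \<le> 32 * s * c (b - 2)" if b: "s / 8 \<le> b" and d: "d > 0" for b d :: real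
  proof -
    define \<phi> where "\<phi> x = max 0 (real s - 1 - b - real x)" for x :: nat
    have "d\<^sup>2 * c (b + d) \<le> (\<Sum>\<omega>\<in>\<Omega>. (\<phi> (X \<omega>))\<^sup>2)"
      unfolding c_def
    proof (rule markov_card[OF fin])
      show "d\<^sup>2 \<le> (\<phi> (X \<omega>))\<^sup>2" if "y \<omega> < - (b + d)" for \<omega>
        using that d by (intro power_mono) (auto simp: \<phi>_def y_def)
    qed auto
    also have "\<dots> \<le> 16 * (\<Sum>\<omega>\<in>\<Omega>. if X \<omega> \<in> {x. real x < real s - 1 - (b - 2)} then real (X \<omega>) else 0)"
      by (rule tail) (use b in \<open>auto simp: \<phi>_def y_def max_def split: if_splits\<close>)
    also have "\<dots> \<le> 16 * (\<Sum>\<omega>\<in>\<Omega>. if y \<omega> < - (b - 2) then 2 * real s else 0)"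
      using b s' by (intro mult_left_mono sum_mono) (auto simp: y_def)
    also have "\<dots> = 32 * s * c (b - 2)"
      using fin by (simp add: c_def sum.If_cases Int_def)
    finally show ?thesis .
  qed
  have c0: "c b \<ge> 0" for b by (simp add: c_def)
  \<comment> \<open>Passing from \<open>s / 8\<close> to \<open>s / 4\<close> and then to
    \<open>s / 2\<close> gains a factor of order \<open>1 / s\<close> each time, and Markov gives a
    third one. Together they beat the weight \<open>s\<^sup>2\<close>; the constants multiply to
    \<open>8192 * 2048 * 8 = 2 ^ 27\<close>.\<close>
  have 1: "(s / 16)\<^sup>2 * c (s / 4) \<le> 32 * s * c (s / 8)"
  proof -
    have "(s / 16)\<^sup>2 * c (s / 4) \<le> (s / 8 - 2)\<^sup>2 * c (s / 4)"
      using s' c0 by (intro mult_right_mono power_mono) auto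
    also have "\<dots> \<le> 32 * s * c (s / 8)"
      using lower[of "s / 8 + 2" "s / 8 - 2"] s' by simp
    finally show ?thesis .
  qed
  have 2: "(s / 8)\<^sup>2 * c (s / 2) \<le> 32 * s * c (s / 4)"
  proof -
    have "(s / 8)\<^sup>2 * c (s / 2) \<le> (s / 4 - 2)\<^sup>2 * c (s / 2)"
      using s' c0 by (intro mult_right_mono power_mono) auto
    also have "\<dots> \<le> 32 * s * c (s / 4)"
      using lower[of "s / 4 + 2" "s / 4 - 2"] s' by simp
    finally show ?thesis .
  qed
  have 3: "s / 8 * c (s / 8) \<le> m"
    unfolding c_def m_def by (rule markov_card[OF fin]) auto
  have "s * (s * c (s / 4)) \<le> s * (8192 * c (s / 8))" "s * (s * c (s / 2)) \<le> s * (2048 * c (s / 4))"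
    using 1 2 by (simp_all add: power2_eq_square)
  then have 12: "s * c (s / 4) \<le> 8192 * c (s / 8)" "s * c (s / 2) \<le> 2048 * c (s / 4)"
    using s' by (simp_all add: mult_le_cancel_left_pos)
  have "s * (s * (s * c (s / 2))) \<le> s * (s * (2048 * c (s / 4)))"
    using 12(2) s' by (intro mult_left_mono) auto
  also have "\<dots> = 2048 * s * (s * c (s / 4))" by simp
  also have "\<dots> \<le> 2048 * s * (8192 * c (s / 8))"
    using 12(1) s' by (intro mult_left_mono) auto
  also have "\<dots> \<le> 2 ^ 27 * m" using 3 by simp
  finally have low: "(real s)\<^sup>2 * c (s / 2) \<le> 2 ^ 27 * m / s"
    using s' by (simp add: field_simps power2_eq_square)
  have "4 / 3 * (\<Sum>\<omega>\<in>\<Omega>. max 0 (y \<omega> - s / 4)) + (real s)\<^sup>2 * c (s / 2) \<le> (1536 + 2 ^ 27) * (m / s)"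
    using upper low by simp
  \<comment> \<open>Needs \<open>s \<ge> 3 * (1536 + 2 ^ 27)\<close>, which is below
    \<open>10 ^ 9\<close>.\<close>
  also have "\<dots> \<le> (s / 3) * (m / s)"
    using s' m0 by (intro mult_right_mono) auto
  also have "\<dots> = m / 3" using s' by simp
  finally show ?thesis by (simp add: c_def m_def)
qed

section \<open>Selecting a rainbow matching from one perfect matching\<close>

text \<open>Choosing representatives greedily, in increasing order of \<open>card (S i)\<close>.\<close>

lemma distinct_representatives:
  assumes "finite I" "\<And>i. i \<in> I \<Longrightarrow> finite (S i)" "\<And>j. card {i\<in>I. card (S i) \<le> j} \<le> j"
  shows "\<exists>g. inj_on g I \<and> (\<forall>i\<in>I. g i \<in> S i)"
  using assms
proof (induction "card I" arbitrary: I)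
  case 0
  then show ?case by auto
next
  case (Suc n)
  \<comment> \<open>An \<open>i\<close> whose set has at least \<open>card I\<close> elements is set
    aside and served last: the others occupy only \<open>n\<close> elements.\<close>
  have "\<exists>i\<in>I. Suc n \<le> card (S i)"
  proof (rule ccontr)
    assume "\<not> ?thesis"
    then have "{i\<in>I. card (S i) \<le> n} = I" by auto
    then show False using Suc.prems(3)[of n] Suc.hyps(2) by simp
  qed
  then obtain i where i: "i \<in> I" "Suc n \<le> card (S i)" by blast
  have c: "card (I - {i}) = n" using Suc.hyps(2) Suc.prems(1) i by simp
  have "\<exists>g. inj_on g (I - {i}) \<and> (\<forall>j\<in>I - {i}. g j \<in> S j)"
  proof (rule Suc.hyps(1))
    fix j
    have "card {l\<in>I - {i}. card (S l) \<le> j} \<le> card {l\<in>I. card (S l) \<le> j}"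
      using Suc.prems(1) by (intro card_mono) auto
    then show "card {l\<in>I - {i}. card (S l) \<le> j} \<le> j" using Suc.prems(3)[of j] by simp
  qed (use c Suc.prems in auto)
  then obtain g where g: "inj_on g (I - {i})" "\<forall>j\<in>I - {i}. g j \<in> S j" by blast
  have "card (g ` (I - {i})) < card (S i)"
    using card_image[OF g(1)] c i by simp
  then obtain z where z: "z \<in> S i" "z \<notin> g ` (I - {i})"
    using Suc.prems(1) by (meson card_mono finite_Diff finite_imageI not_less subsetI)
  have "inj_on (g(i := z)) I"
    using g(1) z(2) by (auto simp: inj_on_def)
  moreover have "\<forall>j\<in>I. (g(i := z)) j \<in> S j" using g(2) z(1) by auto
  ultimately show ?case by blast
qed

text \<open>The slope is 2/3 for negative and 4/3 for positive \<open>y\<close>, with a cap at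
  \<open>s / 3\<close> from \<open>y = s / 4\<close> on. The penalty below \<open>- (s / 2)\<close>
  outweighs \<open>s\<close> terms of the maximal size \<open>s / 3\<close>.\<close>

definition truncated_excess :: "nat \<Rightarrow> real \<Rightarrow> real" where
  "truncated_excess s y =
    y + \<bar>y\<bar> / 3 - 4 / 3 * max 0 (y - s / 4) - (if y < - (s / 2) then (real s)\<^sup>2 else 0)"

text \<open>If some term carries the penalty, it dominates. Otherwise at least \<open>j + 1\<close>
  terms are at most \<open>- 2 / 3 * (s - 1 - j)\<close> and the at most \<open>s - 1 - j\<close>
  others are at most \<open>s / 3\<close>. The lower limit \<open>- (s / 2)\<close> forces
  \<open>j + 1 \<ge> s / 2\<close>, which balances the two.\<close>

lemma sum_truncated_excess_nonpos:
  fixes X :: "'i \<Rightarrow> nat"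
  assumes fin: "finite I" and c: "card I = s" and s: "s \<ge> 1"
    and j: "card {i\<in>I. X i \<le> j} > j"
  shows "(\<Sum>i\<in>I. truncated_excess s (real (X i) - (real s - 1))) \<le> 0"
proof -
  define y where "y i = real (X i) - (real s - 1)" for i
  define \<psi> where "\<psi> = truncated_excess s"
  have top: "\<psi> z \<le> s / 3" for z
  proof -
    have "0 \<le> (if z < - (s / 2) then (real s)\<^sup>2 else 0)" by simp
    then have "\<psi> z \<le> z + \<bar>z\<bar> / 3 - 4 / 3 * max 0 (z - s / 4)"
      unfolding \<psi>_def truncated_excess_def by linarith
    also have "\<dots> \<le> s / 3" by (auto simp: max_def abs_if)
    finally show ?thesis .
  qed
  define A where "A = {i\<in>I. X i \<le> j}"
  have A: "A \<subseteq> I" "finite A" "card A \<ge> Suc j" using fin j by (auto simp: A_def)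
  have js: "j < s" using card_mono[OF fin A(1)] A(3) c by simp
  have "(\<Sum>i\<in>I. \<psi> (y i)) \<le> 0"
  proof (cases "\<exists>i\<in>I. y i < - (s / 2)")
    case True
    then obtain i where i: "i \<in> I" "y i < - (s / 2)" by blast
    have "(\<Sum>l\<in>I. \<psi> (y l)) = \<psi> (y i) + (\<Sum>l\<in>I - {i}. \<psi> (y l))"
      using fin i by (simp add: sum.remove)
    also have "\<dots> \<le> - (real s)\<^sup>2 + (\<Sum>l\<in>I - {i}. s / 3)"
      using i s by (intro add_mono sum_mono top) (auto simp: \<psi>_def truncated_excess_def)
    also have "\<dots> = - (real s)\<^sup>2 + (real s - 1) * (s / 3)"
      using fin i c s by (simp add: of_nat_diff)
    also have "\<dots> \<le> 0"
    proof -
      have "(real s - 1) * (s / 3) \<le> real s * real s" by (intro mult_mono) auto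
      then show ?thesis by (simp add: power2_eq_square)
    qed
    finally show ?thesis .
  next
    case False
    have "A \<noteq> {}" using A by auto
    then obtain i where "i \<in> A" by blast
    then have "- (s / 2) \<le> y i" "X i \<le> j" using False A(1) by (force simp: A_def)+
    then have half: "s / 2 \<le> real j + 1" by (simp add: y_def)
    have neg: "\<psi> (y i) \<le> - (2 / 3 * (real s - 1 - real j))" if "i \<in> A" for i
    proof -
      have "real (X i) \<le> real j" "real j \<le> real s - 1" using that js by (auto simp: A_def)
      then have "y i \<le> - (real s - 1 - real j)" "y i \<le> 0" by (auto simp: y_def)
      moreover have "\<not> y i < - (s / 2)" using that A(1) False by auto
      then have "\<psi> (y i) = 2 / 3 * y i" using \<open>y i \<le> 0\<close> by (simp add: \<psi>_def truncated_excess_def)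
      moreover have "2 / 3 * y i \<le> 2 / 3 * (- (real s - 1 - real j))"
        using \<open>y i \<le> - (real s - 1 - real j)\<close> by (rule mult_left_mono) simp
      ultimately show ?thesis by (simp only: mult_minus_right)
    qed
    have "(\<Sum>i\<in>I. \<psi> (y i)) = (\<Sum>i\<in>A. \<psi> (y i)) + (\<Sum>i\<in>I - A. \<psi> (y i))"
      using sum.subset_diff[OF A(1) fin, of "\<lambda>i. \<psi> (y i)"] by simp
    also have "\<dots> \<le> (\<Sum>i\<in>A. - (2 / 3 * (real s - 1 - real j))) + (\<Sum>i\<in>I - A. s / 3)"
      by (intro add_mono sum_mono neg top)
    also have "\<dots> = - (card A * (2 / 3 * (real s - 1 - real j))) + (real s - card A) * (s / 3)"
    proof -
      have "card A \<le> s" using card_mono[OF fin A(1)] c by simp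
      then show ?thesis using A c by (simp add: card_Diff_subset of_nat_diff)
    qed
    also have "\<dots> \<le> - ((real j + 1) * (2 / 3 * (real s - 1 - real j))) + (real s - 1 - real j) * (s / 3)"
      using A(3) js by (intro add_mono le_imp_neg_le mult_right_mono) auto
    also have "\<dots> = (real s - 1 - real j) * (2 / 3) * (s / 2 - (real j + 1))"
      by (simp add: field_simps)
    also have "\<dots> \<le> 0"
      using js half by (intro mult_nonneg_nonpos) auto
    finally show ?thesis .
  qed
  then show ?thesis by (simp add: \<psi>_def y_def)
qed

text \<open>Distinct indices give disjoint tuples, since each \<open>\<omega> c\<close> is
  injective.\<close>

lemma rainbow_matching_edges:
  assumes \<omega>: "\<omega> \<in> perm_tuples n k" and g: "inj_on g {1..s}" "\<forall>i\<in>{1..s}. g i \<in> hits n k (\<F> i) \<omega>"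
  shows "rainbow_matching k s \<F> (\<lambda>i. edge k \<omega> (g i))"
  unfolding rainbow_matching_def
proof (intro conjI ballI allI impI)
  show "edge k \<omega> (g i) \<in> \<F> i" if "i \<in> {1..s}" for i
    using that g(2) by (auto simp: hits_def)
next
  fix i j assume ij: "1 \<le> i \<and> i < j \<and> j \<le> s"
  have "g i \<noteq> g j" using ij inj_on_eq_iff[OF g(1), of i j] by simp
  moreover have "inj (\<omega> c)" if "c \<in> {1..k}" for c
    using that \<omega> by (auto simp: perm_tuples_def PiE_iff intro: permutes_inj)
  ultimately show "\<not> tuples_intersect k (edge k \<omega> (g i)) (edge k \<omega> (g j))"
    by (auto simp: tuples_intersect_def edge_def inj_eq)
qed

text \<open>With exactly one tuple above the threshold, \<open>y\<close> has mean
  \<open>1 / n ^ (k - 1)\<close>, positive and at most 1 as \<open>relative_concentration\<close>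
  requires. The truncation costs at most the bonus \<open>\<bar>y\<bar> / 3\<close>, so the sum
  stays at least that of \<open>y\<close>.\<close>

lemma sum_truncated_excess_pos:
  assumes n: "n \<ge> 1" and k: "k \<ge> 1" and s: "s \<ge> 10 ^ 9"
    and F: "F \<subseteq> tuples n k" "card F = (s - 1) * n ^ (k - 1) + 1"
  shows "0 < (\<Sum>\<omega>\<in>perm_tuples n k. truncated_excess s (real (card (hits n k F \<omega>)) - (real s - 1)))"
proof -
  define \<Omega> where "\<Omega> = perm_tuples n k"
  define y where "y \<omega> = real (card (hits n k F \<omega>)) - (real s - 1)" for \<omega>
  have fin: "finite \<Omega>" by (simp add: \<Omega>_def)
  have nk: "real n ^ k = n * n ^ (k - 1)" using k by (simp flip: power_Suc)
  have "fact n = real n * fact (n - 1)" using n by (simp add: fact_reduce)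
  then have cO: "real (card \<Omega>) = n * n ^ (k - 1) * fact (n - 1) ^ k"
    by (simp add: \<Omega>_def card_perm_tuples power_mult_distrib nk)
  have "(\<Sum>\<omega>\<in>\<Omega>. real (card (hits n k F \<omega>))) = ((real s - 1) * n ^ (k - 1) + 1) * n * fact (n - 1) ^ k"
  proof -
    have "real (s - 1) = real s - 1" using s by (simp add: of_nat_diff)
    then show ?thesis
      unfolding \<Omega>_def of_nat_sum[symmetric] sum_card_hits[OF F(1)] F(2)
      by (simp del: One_nat_def)
  qed
  then have sumy: "(\<Sum>\<omega>\<in>\<Omega>. y \<omega>) = n * fact (n - 1) ^ k"
    unfolding y_def sum_subtractf sum_constant cO by (simp add: algebra_simps)
  have mean: "0 < (\<Sum>\<omega>\<in>\<Omega>. y \<omega>)" using n by (simp add: sumy)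
  have "(\<Sum>\<omega>\<in>\<Omega>. y \<omega>) \<le> card \<Omega>"
  proof -
    have "1 \<le> real n ^ (k - 1)" using n by simp
    then have "real n * fact (n - 1) ^ k * 1 \<le> real n * fact (n - 1) ^ k * real n ^ (k - 1)"
      by (rule mult_left_mono) simp
    then show ?thesis by (simp add: sumy cO mult_ac)
  qed
  with mean have "4 / 3 * (\<Sum>\<omega>\<in>\<Omega>. max 0 (y \<omega> - s / 4)) + (real s)\<^sup>2 * card {\<omega>\<in>\<Omega>. y \<omega> < - (s / 2)}
      \<le> (\<Sum>\<omega>\<in>\<Omega>. \<bar>y \<omega>\<bar>) / 3"
    unfolding y_def
    by (intro relative_concentration fin s) (auto simp: \<Omega>_def intro!: sum_var_card_hits n)
  moreover have "(\<Sum>\<omega>\<in>\<Omega>. truncated_excess s (y \<omega>)) = (\<Sum>\<omega>\<in>\<Omega>. y \<omega>) + (\<Sum>\<omega>\<in>\<Omega>. \<bar>y \<omega>\<bar>) / 3 -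
      4 / 3 * (\<Sum>\<omega>\<in>\<Omega>. max 0 (y \<omega> - s / 4)) - (real s)\<^sup>2 * card {\<omega>\<in>\<Omega>. y \<omega> < - (s / 2)}"
    using fin by (simp add: truncated_excess_def sum.distrib sum_subtractf sum.If_cases Int_def
        sum_distrib_left sum_divide_distrib)
  ultimately have "0 < (\<Sum>\<omega>\<in>\<Omega>. truncated_excess s (y \<omega>))" using mean by linarith
  then show ?thesis by (simp add: \<Omega>_def y_def)
qed

theorem theorem1:
  "\<exists>s0::nat. \<forall>(n::nat) (k::nat) (s::nat) (\<F> :: nat \<Rightarrow> (nat \<Rightarrow> nat) set).
     n \<ge> 1 \<longrightarrow> k \<ge> 1 \<longrightarrow> s \<ge> s0 \<longrightarrow>
     (\<forall>i\<in>{1..s}. \<F> i \<subseteq> tuples n k) \<longrightarrow>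
     (\<forall>i\<in>{1..s}. int (card (\<F> i)) > (int s - 1) * int n ^ (k - 1)) \<longrightarrow>
     (\<exists>F. rainbow_matching k s \<F> F)"
proof (rule exI[of _ "10 ^ 9"], intro allI impI)
  fix n k s :: nat and \<F> :: "nat \<Rightarrow> (nat \<Rightarrow> nat) set"
  assume n: "n \<ge> 1" and k: "k \<ge> 1" and s: "s \<ge> 10 ^ 9"
    and sub: "\<forall>i\<in>{1..s}. \<F> i \<subseteq> tuples n k"
    and big: "\<forall>i\<in>{1..s}. int (card (\<F> i)) > (int s - 1) * int n ^ (k - 1)"
  have s1: "s \<ge> 1" using s by simp
  \<comment> \<open>The families are trimmed to the smallest admissible size to keep the mean of the
    excess at most 1.\<close>
  have "\<exists>F. F \<subseteq> \<F> i \<and> card F = (s - 1) * n ^ (k - 1) + 1" if "i \<in> {1..s}" for i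
  proof -
    have "int (card (\<F> i)) > int ((s - 1) * n ^ (k - 1))"
      using big that s1 by (simp add: of_nat_diff)
    then have "(s - 1) * n ^ (k - 1) + 1 \<le> card (\<F> i)" by linarith
    then show ?thesis by (metis obtain_subset_with_card_n)
  qed
  then obtain \<G> where \<G>: "\<And>i. i \<in> {1..s} \<Longrightarrow> \<G> i \<subseteq> \<F> i"
    "\<And>i. i \<in> {1..s} \<Longrightarrow> card (\<G> i) = (s - 1) * n ^ (k - 1) + 1"
    by metis
  let ?\<psi> = "\<lambda>i \<omega>. truncated_excess s (real (card (hits n k (\<G> i) \<omega>)) - (real s - 1))"
  have "0 < (\<Sum>i\<in>{1..s}. \<Sum>\<omega>\<in>perm_tuples n k. ?\<psi> i \<omega>)"
  proof (rule sum_pos)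
    show "0 < (\<Sum>\<omega>\<in>perm_tuples n k. ?\<psi> i \<omega>)" if "i \<in> {1..s}" for i
    proof (rule sum_truncated_excess_pos[OF n k s])
      show "\<G> i \<subseteq> tuples n k" using sub \<G>(1)[OF that] that by blast
    qed (rule \<G>(2)[OF that])
  qed (use s1 in auto)
  also have "\<dots> = (\<Sum>\<omega>\<in>perm_tuples n k. \<Sum>i\<in>{1..s}. ?\<psi> i \<omega>)" by (rule sum.swap)
  finally obtain \<omega> where \<omega>: "\<omega> \<in> perm_tuples n k" "0 < (\<Sum>i\<in>{1..s}. ?\<psi> i \<omega>)"
    by (metis (no_types, lifting) leD linorder_le_less_linear sum_nonpos)
  \<comment> \<open>For the \<open>\<omega>\<close> found by averaging, a violation of the greedy
    condition would make the sum over \<open>i\<close> nonpositive.\<close>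
  have "card {i\<in>{1..s}. card (hits n k (\<G> i) \<omega>) \<le> j} \<le> j" for j
  proof (rule ccontr)
    assume "\<not> ?thesis"
    then have "(\<Sum>i\<in>{1..s}. ?\<psi> i \<omega>) \<le> 0"
      using s1 by (intro sum_truncated_excess_nonpos[where j = j]) auto
    then show False using \<omega>(2) by simp
  qed
  then obtain g where g: "inj_on g {1..s}" "\<forall>i\<in>{1..s}. g i \<in> hits n k (\<G> i) \<omega>"
    using distinct_representatives[of "{1..s}" "\<lambda>i. hits n k (\<G> i) \<omega>"] by auto
  have "\<forall>i\<in>{1..s}. g i \<in> hits n k (\<F> i) \<omega>"
    using g(2) \<G>(1) by (fastforce simp: hits_def)
  then show "\<exists>F. rainbow_matching k s \<F> F"
    using rainbow_matching_edges[OF \<omega>(1) g(1)] by blast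
qed

end
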